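(* No non-constant flow space in $\Sigma$ is flow equivalent to a non-constant flow space in $\mathrm T$.
   Context: Let $F_2$ be free on $\{a,b\}$, and consider the positive endomorphisms $\sigma\colon a\mapsto aabaabab,\ b\mapsto aabab$; $\tau\colon a\mapsto aabaabab,\ b\mapsto abaab$; $\rho\colon a\mapsto ba,\ b\mapsto bba$. Let $W_2$ be an oriented wedge of two circles labelled $a$ and $b$, and for $\theta\in\{\sigma,\tau,\rho\}$ let $f_\theta\colon W_2\to W_2$ be a positive map (continuous surjection, wedge point to wedge point, orientation preserving on each circle, locally injective away from the wedge point) whose image of circle $x$ traverses, in order, the circles spelled by the word $\theta(x)$. Flow space: compact metrizable space of dimension one with continuous $\mathbb R$-action without fixed points; flow equivalence: homeomorphism mapping orbits to orbits preserving flow orientation. An expansion of $\mathbb X$ about a point: oriented wedges $X_i$, positive maps $f_i\colon X_{i+1}\to X_i$, projections $p_i\colon\mathbb X\to X_i$ (continuous surjections, locally injective and orientation preserving along orbits, sending the point to the wedge point) with $p_n=f_n\circ\cdots\circ f_{m-1}\circ p_m$ and $x\mapsto(p_i(x))_i$ a homeomorphism onto $\varprojlim(X_i,f_i)$. $\Sigma$ is the family of flow spaces admitting an expansion with every $X_i=W_2$ and every $f_i\in\{f_\sigma,f_\rho\}$; $\mathrm T$ likewise with $f_i\in\{f_\tau,f_\rho\}$. Such expansions are called admissible and are identified with the corresponding infinite sequence of symbols. Two sequences $(s_i)$, $(t_i)$ are tail equivalent if there are $k,l$ with $s_{k+j}=t_{l+j}$ for all $j\ge0$. A space in $\Sigma$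 or $\mathrm T$ is non-constant if it has an admissible expansion whose symbol sequence is not tail equivalent to a constant sequence. *)

theory Defs
  imports "HOL-Analysis.Analysis"
begin

datatype letter = La | Lb

datatype sym = Sig | Tau | Rho

fun word :: "sym \<Rightarrow> letter \<Rightarrow> letter list" where
  "word Sig La = [La,La,Lb,La,La,Lb,La,Lb]"
| "word Sig Lb = [La,La,Lb,La,Lb]"
| "word Tau La = [La,La,Lb,La,La,Lb,La,Lb]"
| "word Tau Lb = [La,Lb,La,La,Lb]"
| "word Rho La = [Lb,La]"
| "word Rho Lb = [Lb,Lb,La]"

text \<open>Circle a: centre -1, radius 1; circle b: centre 1, radius 1; they meet only in
  the wedge point 0. gam c is the (1-periodic) orientation-defining parametrisation
  of circle c, with gam c 0 = 0.\<close>

fun gam :: "letter \<Rightarrow> real \<Rightarrow> complex" where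
  "gam La t = cis (2 * pi * t) - 1"
| "gam Lb t = 1 - cis (2 * pi * t)"

definition W2 :: "complex set" where
  "W2 = range (gam La) \<union> range (gam Lb)"

definition W2top :: "complex topology" where
  "W2top = subtopology euclidean W2"

text \<open>A positive map W2 -> W2 whose image of circle c traverses, in order,
  the circles spelled by the word w c: circle c is cut at parameters
  0 = t_0 < ... < t_k = 1 and the j-th piece is mapped by an orientation preserving
  homeomorphism onto the whole circle (w c) ! j.\<close>

definition positive_map :: "(letter \<Rightarrow> letter list) \<Rightarrow> (complex \<Rightarrow> complex) \<Rightarrow> bool" where
  "positive_map w f \<longleftrightarrow>
     continuous_map W2top W2top f \<and> f ` W2 = W2 \<and> f 0 = 0 \<and>
     (\<forall>c. \<exists>t :: nat \<Rightarrow> real. t 0 = 0 \<and> t (length (w c)) = 1 \<and>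
        (\<forall>j < length (w c). t j < t (Suc j) \<and>
           (\<exists>u. continuous_on {t j..t (Suc j)} u \<and> strict_mono_on {t j..t (Suc j)} u \<and>
                u (t j) = 0 \<and> u (t (Suc j)) = 1 \<and>
                (\<forall>s\<in>{t j..t (Suc j)}. f (gam c s) = gam (w c ! j) (u s)))))"

definition cov_dim_le :: "'a topology \<Rightarrow> nat \<Rightarrow> bool" where
  "cov_dim_le X n \<longleftrightarrow>
     (\<forall>UU. finite UU \<and> (\<forall>U\<in>UU. openin X U) \<and> topspace X \<subseteq> (\<Union>UU) \<longrightarrow>
        (\<exists>VV. finite VV \<and> (\<forall>V\<in>VV. openin X V) \<and> topspace X \<subseteq> (\<Union>VV) \<and>
             (\<forall>V\<in>VV. \<exists>U\<in>UU. V \<subseteq> U) \<and>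
             (\<forall>x\<in>topspace X. card {V\<in>VV. x \<in> V} \<le> n + 1)))"

definition dimension_one :: "'a topology \<Rightarrow> bool" where
  "dimension_one X \<longleftrightarrow> cov_dim_le X 1 \<and> \<not> cov_dim_le X 0"

definition flow_space :: "'a topology \<Rightarrow> (real \<Rightarrow> 'a \<Rightarrow> 'a) \<Rightarrow> bool" where
  "flow_space X \<phi> \<longleftrightarrow>
     compact_space X \<and> metrizable_space X \<and> dimension_one X \<and>
     continuous_map (prod_topology euclideanreal X) X (\<lambda>(t, x). \<phi> t x) \<and>
     (\<forall>x\<in>topspace X. \<phi> 0 x = x) \<and>
     (\<forall>x\<in>topspace X. \<forall>s t. \<phi> (s + t) x = \<phi> s (\<phi> t x)) \<and>
     (\<forall>x\<in>topspace X. \<exists>t. \<phi> t x \<noteq> x)"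

definition orbit :: "(real \<Rightarrow> 'a \<Rightarrow> 'a) \<Rightarrow> 'a \<Rightarrow> 'a set" where
  "orbit \<phi> x = range (\<lambda>t. \<phi> t x)"

definition flow_equiv :: "'a topology \<Rightarrow> (real \<Rightarrow> 'a \<Rightarrow> 'a) \<Rightarrow> 'b topology \<Rightarrow> (real \<Rightarrow> 'b \<Rightarrow> 'b) \<Rightarrow> bool" where
  "flow_equiv X \<phi> Y \<psi> \<longleftrightarrow>
     (\<exists>h. homeomorphic_map X Y h \<and>
          (\<forall>x\<in>topspace X. h ` orbit \<phi> x = orbit \<psi> (h x) \<and>
             (\<exists>\<alpha>. strict_mono \<alpha> \<and> continuous_on UNIV \<alpha> \<and>
                  (\<forall>t. h (\<phi> t x) = \<psi> (\<alpha> t) (h x)))))"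

text \<open>A path g : R -> W2 that is locally injective and orientation preserving:
  locally on each side of every time t it runs forward along one circle.\<close>

definition fwd_path :: "(real \<Rightarrow> complex) \<Rightarrow> bool" where
  "fwd_path g \<longleftrightarrow>
     (\<forall>t. \<exists>\<epsilon>>0. \<exists>c c' u v.
        continuous_on {t - \<epsilon>..t} u \<and> strict_mono_on {t - \<epsilon>..t} u \<and>
        (\<forall>s\<in>{t - \<epsilon>..t}. g s = gam c (u s)) \<and>
        continuous_on {t..t + \<epsilon>} v \<and> strict_mono_on {t..t + \<epsilon>} v \<and>
        (\<forall>s\<in>{t..t + \<epsilon>}. g s = gam c' (v s)))"

definition invlim :: "(sym \<Rightarrow> complex \<Rightarrow> complex) \<Rightarrow> (nat \<Rightarrow> sym) \<Rightarrow> (nat \<Rightarrow> complex) set" where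
  "invlim f s = {z. \<forall>i. z i \<in> W2 \<and> z i = f (s i) (z (Suc i))}"

definition expansion ::
  "'a topology \<Rightarrow> (real \<Rightarrow> 'a \<Rightarrow> 'a) \<Rightarrow> 'a \<Rightarrow> (sym \<Rightarrow> complex \<Rightarrow> complex) \<Rightarrow>
   (nat \<Rightarrow> sym) \<Rightarrow> (nat \<Rightarrow> 'a \<Rightarrow> complex) \<Rightarrow> bool" where
  "expansion X \<phi> x0 f s p \<longleftrightarrow>
     x0 \<in> topspace X \<and>
     (\<forall>i. continuous_map X W2top (p i) \<and> p i ` topspace X = W2 \<and> p i x0 = 0 \<and>
          (\<forall>x\<in>topspace X. fwd_path (\<lambda>t. p i (\<phi> t x))) \<and>
          (\<forall>x\<in>topspace X. p i x = f (s i) (p (Suc i) x))) \<and>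
     homeomorphic_map X (subtopology (product_topology (\<lambda>i. W2top) UNIV) (invlim f s))
       (\<lambda>x i. p i x)"

definition tail_equiv :: "(nat \<Rightarrow> 'c) \<Rightarrow> (nat \<Rightarrow> 'c) \<Rightarrow> bool" where
  "tail_equiv s t \<longleftrightarrow> (\<exists>k l. \<forall>j. s (k + j) = t (l + j))"

definition nonconstant_in ::
  "sym set \<Rightarrow> (sym \<Rightarrow> complex \<Rightarrow> complex) \<Rightarrow> 'a topology \<Rightarrow> (real \<Rightarrow> 'a \<Rightarrow> 'a) \<Rightarrow> bool" where
  "nonconstant_in S f X \<phi> \<longleftrightarrow>
     flow_space X \<phi> \<and>
     (\<exists>x0 s p. expansion X \<phi> x0 f s p \<and> (\<forall>i. s i \<in> S) \<and>
               \<not> (\<exists>c. tail_equiv s (\<lambda>_. c)))"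

abbreviation nonconstant_Sigma where
  "nonconstant_Sigma \<equiv> nonconstant_in {Sig, Rho}"

abbreviation nonconstant_T where
  "nonconstant_T \<equiv> nonconstant_in {Tau, Rho}"

end

theory Submission
  imports Defs
begin

text \<open>The two families are already separated by the homeomorphism type, through the first
  cohomology set with coefficients in the symmetric group S3. On the wedge of two circles this is
  the set of pairs of elements of S3 modulo simultaneous conjugation, and on an inverse limit it
  is the direct limit over the levels. The words of Sig and Rho define automorphisms of the free
  group, so for a space in the first family all classes of level 0 stay distinct in the limit.
  The word of Tau is not injective on classes: for a reflection s and a rotation r of order 3, the
  pairs (s, 1) and (s, r) have conjugate images. As Tau occurs infinitely often in a
  non-constant sequence and the set of classes of a level is finite, the cohomology set of a space
  in the second family is strictly smaller.

  Cohomology is taken in the style of Alexander and Spanier: a cocycle is an arbitrary function on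
  the pairs of points that are close at some level, and it descends to that level along
  any (discontinuous) section of the projection.\<close>

subsection \<open>Cocycles and holonomy\<close>

text \<open>Distances are measured through \<open>p\<close>, so one notion serves the wedge
  (\<open>p\<close> the identity), an interval, and the space seen at one level. The group is
  written additively, but \<open>group_add\<close> is not commutative, so the order of summands
  matters.\<close>

definition cocycle_on ::
  "('x \<Rightarrow> 'm::metric_space) \<Rightarrow> 'x set \<Rightarrow> real \<Rightarrow> ('x \<Rightarrow> 'x \<Rightarrow> 'g::group_add) \<Rightarrow> bool" where
  "cocycle_on p S \<delta> c \<longleftrightarrow>
     (\<forall>x\<in>S. \<forall>y\<in>S. \<forall>z\<in>S. dist (p x) (p y) < \<delta> \<longrightarrow> dist (p y) (p z) < \<delta> \<longrightarrow>
        dist (p x) (p z) < \<delta> \<longrightarrow> c x y + c y z = c x z)"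

text \<open>The scale is existential and \<open>g\<close> is an arbitrary function without
  continuity: a class is a germ of cocycles near the diagonal.\<close>

definition cohomologous_on ::
  "('x \<Rightarrow> 'm::metric_space) \<Rightarrow> 'x set \<Rightarrow> ('x \<Rightarrow> 'x \<Rightarrow> 'g::group_add) \<Rightarrow> ('x \<Rightarrow> 'x \<Rightarrow> 'g) \<Rightarrow> bool" where
  "cohomologous_on p S c c' \<longleftrightarrow>
     (\<exists>\<delta>>0. \<exists>g. \<forall>x\<in>S. \<forall>y\<in>S. dist (p x) (p y) < \<delta> \<longrightarrow> c' x y = - g x + c x y + g y)"

lemmas group_normalize = minus_add add.assoc diff_conv_add_uminus

lemma cocycle_onD:
  assumes "cocycle_on p S \<delta> c" "x \<in> S" "y \<in> S" "z \<in> S"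
    "dist (p x) (p y) < \<delta>" "dist (p y) (p z) < \<delta>" "dist (p x) (p z) < \<delta>"
  shows "c x y + c y z = c x z"
  using assms by (auto simp: cocycle_on_def)

lemma cocycle_on_refl:
  assumes "cocycle_on p S \<delta> c" "\<delta> > 0" "x \<in> S"
  shows "c x x = 0"
proof -
  have "c x x + c x x = c x x + 0"
    using cocycle_onD[OF assms(1) assms(3) assms(3) assms(3)] assms(2) by simp
  thus ?thesis by (simp only: add_left_cancel)
qed

lemma cocycle_on_sym:
  assumes "cocycle_on p S \<delta> c" "x \<in> S" "y \<in> S" "dist (p x) (p y) < \<delta>"
  shows "c y x = - c x y"
proof -
  have d: "\<delta> > 0" using assms(4) zero_le_dist[of "p x" "p y"] by linarith
  have "c x y + c y x = c x x"
    using cocycle_onD[OF assms(1-3) assms(2)] assms(4) d by (simp add: dist_commute)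
  hence "c x y + c y x = 0" using cocycle_on_refl[OF assms(1) d assms(2)] by simp
  thus ?thesis by (rule minus_unique[symmetric])
qed

lemma cocycle_on_pullback:
  assumes "cocycle_on p S \<delta> c" "q ` T \<subseteq> S"
    "\<And>x y. x \<in> T \<Longrightarrow> y \<in> T \<Longrightarrow> dist (r x) (r y) < \<epsilon> \<Longrightarrow> dist (p (q x)) (p (q y)) < \<delta>"
  shows "cocycle_on r T \<epsilon> (\<lambda>x y. c (q x) (q y))"
  unfolding cocycle_on_def
proof (intro ballI impI)
  fix x y z assume *: "x \<in> T" "y \<in> T" "z \<in> T" "dist (r x) (r y) < \<epsilon>" "dist (r y) (r z) < \<epsilon>"
    "dist (r x) (r z) < \<epsilon>"
  thus "c (q x) (q y) + c (q y) (q z) = c (q x) (q z)"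
    using cocycle_onD[OF assms(1), of "q x" "q y" "q z"] assms(2,3) by (simp add: image_subset_iff)
qed

lemma cohomologous_on_pullback:
  assumes "cohomologous_on p S c c'" "q ` T \<subseteq> S"
    "\<And>\<delta>. \<delta> > 0 \<Longrightarrow> \<exists>\<epsilon>>0. \<forall>x\<in>T. \<forall>y\<in>T. dist (r x) (r y) < \<epsilon> \<longrightarrow> dist (p (q x)) (p (q y)) < \<delta>"
  shows "cohomologous_on r T (\<lambda>x y. c (q x) (q y)) (\<lambda>x y. c' (q x) (q y))"
proof -
  obtain \<delta> g where \<delta>: "\<delta> > 0"
    and g: "\<And>x y. x \<in> S \<Longrightarrow> y \<in> S \<Longrightarrow> dist (p x) (p y) < \<delta> \<Longrightarrow> c' x y = - g x + c x y + g y"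
    using assms(1) by (auto simp: cohomologous_on_def)
  obtain \<epsilon> where "\<epsilon> > 0" "\<And>x y. x \<in> T \<Longrightarrow> y \<in> T \<Longrightarrow> dist (r x) (r y) < \<epsilon> \<Longrightarrow> dist (p (q x)) (p (q y)) < \<delta>"
    using assms(3)[OF \<delta>] by blast
  thus ?thesis unfolding cohomologous_on_def
    using g assms(2) by (intro exI[of _ \<epsilon>] conjI exI[of _ "\<lambda>x. g (q x)"]) (auto simp: image_subset_iff)
qed

lemma cohomologous_on_sym:
  assumes "cohomologous_on p S c c'"
  shows "cohomologous_on p S c' c"
proof -
  obtain \<delta> g where \<delta>: "\<delta> > 0"
    and g: "\<And>x y. x \<in> S \<Longrightarrow> y \<in> S \<Longrightarrow> dist (p x) (p y) < \<delta> \<Longrightarrow> c' x y = - g x + c x y + g y"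
    using assms(1) by (auto simp: cohomologous_on_def)
  show ?thesis unfolding cohomologous_on_def
    using \<delta> g by (intro exI[of _ \<delta>] conjI exI[of _ "\<lambda>x. - g x"]) (auto simp: add.assoc)
qed

lemma cohomologous_on_trans:
  assumes "cohomologous_on p S c c'" "cohomologous_on p S c' c''"
  shows "cohomologous_on p S c c''"
proof -
  obtain \<delta> g where \<delta>: "\<delta> > 0"
    and g: "\<And>x y. x \<in> S \<Longrightarrow> y \<in> S \<Longrightarrow> dist (p x) (p y) < \<delta> \<Longrightarrow> c' x y = - g x + c x y + g y"
    using assms(1) by (auto simp: cohomologous_on_def)
  obtain \<delta>' g' where \<delta>': "\<delta>' > 0"
    and g': "\<And>x y. x \<in> S \<Longrightarrow> y \<in> S \<Longrightarrow> dist (p x) (p y) < \<delta>' \<Longrightarrow> c'' x y = - g' x + c' x y + g' y"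
    using assms(2) by (auto simp: cohomologous_on_def)
  show ?thesis unfolding cohomologous_on_def
    using \<delta> \<delta>' g g'
    by (intro exI[of _ "min \<delta> \<delta>'"] conjI exI[of _ "\<lambda>x. g x + g' x"])
      (auto simp: group_normalize simp del: add_uminus_conv_diff)
qed

section \<open>Lifts along an interval\<close>

text \<open>The pullback of a cocycle to an interval is locally the coboundary of \<open>L\<close>.\<close>

definition lifts :: "(real \<Rightarrow> real \<Rightarrow> 'g::group_add) \<Rightarrow> real \<Rightarrow> real \<Rightarrow> (real \<Rightarrow> 'g) \<Rightarrow> bool" where
  "lifts d a b L \<longleftrightarrow> (\<exists>\<eta>>0. \<forall>s\<in>{a..b}. \<forall>t\<in>{a..b}. dist s t < \<eta> \<longrightarrow> d s t = - L s + L t)"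

text \<open>Potentials exist on short intervals and can be glued at a common endpoint, so bisection
  gives one on the whole interval. The scale \<open>\<eta>\<close> stays the same under
  gluing.\<close>

lemma lifts_exists:
  assumes "cocycle_on (\<lambda>t. t) {a..b} \<eta> d" "\<eta> > 0" "a \<le> b"
  shows "\<exists>L. lifts d a b L"
proof -
  define P where "P u v \<longleftrightarrow> (a \<le> u \<longrightarrow> v \<le> b \<longrightarrow>
    (\<exists>L. \<forall>s\<in>{u..v}. \<forall>t\<in>{u..v}. dist s t < \<eta> \<longrightarrow> d s t = - L s + L t))" for u v
  have "P a b"
  proof (rule Bolzano[OF assms(3)])
    fix u v w assume *: "P u v" "P v w" "u \<le> v" "v \<le> w"
    show "P u w" unfolding P_def
    proof (intro impI)
      assume uw: "a \<le> u" "w \<le> b"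
      obtain L where L: "\<And>s t. s \<in> {u..v} \<Longrightarrow> t \<in> {u..v} \<Longrightarrow> dist s t < \<eta> \<Longrightarrow> d s t = - L s + L t"
        using * uw unfolding P_def by (metis order_trans)
      obtain M where M: "\<And>s t. s \<in> {v..w} \<Longrightarrow> t \<in> {v..w} \<Longrightarrow> dist s t < \<eta> \<Longrightarrow> d s t = - M s + M t"
        using * uw unfolding P_def by (metis order_trans)
      \<comment> \<open>The constant \<open>L v - M v\<close> makes both potentials agree at
        \<open>v\<close>; standing on the left, it cancels in \<open>- N s + N t\<close>.\<close>
      define N where "N t = (if t \<le> v then L t else L v - M v + M t)" for t
      have less: "d s t = - N s + N t" if st: "s \<in> {u..w}" "t \<in> {u..w}" "dist s t < \<eta>" "s \<le> t" for s t
      proof -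
        consider "t \<le> v" | "v < s" | "s \<le> v" "v < t" by linarith
        thus ?thesis
        proof cases
          case 1 thus ?thesis using L[of s t] st by (simp add: N_def)
        next
          case 2
          have "d s t = - M s + M t" using M[of s t] st 2 by simp
          also have "\<dots> = - (L v - M v + M s) + (L v - M v + M t)"
            by (simp only: minus_add add.assoc minus_add_cancel diff_conv_add_uminus)
          finally show ?thesis using 2 st by (simp add: N_def)
        next
          case 3
          have c: "dist s v < \<eta>" "dist v t < \<eta>" using 3 st by (auto simp: dist_real_def)
          have "d s t = d s v + d v t"
            using cocycle_onD[OF assms(1), of s v t] st 3 c uw * by simp
          also have "d s v = - L s + L v" using L[of s v] c 3 st * by simp
          also have "d v t = - M v + M t" using M[of v t] c 3 st * by simp
          finally show ?thesis using 3 by (simp add: N_def group_normalize del: add_uminus_conv_diff)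
        qed
      qed
      have "d s t = - N s + N t" if st: "s \<in> {u..w}" "t \<in> {u..w}" "dist s t < \<eta>" for s t
      proof (cases "s \<le> t")
        case True thus ?thesis using less st by blast
      next
        case False
        have "d s t = - d t s"
          using cocycle_on_sym[OF assms(1), of t s] st uw by (auto simp: dist_commute)
        also have "d t s = - N t + N s" using less[of t s] st False by (simp add: dist_commute)
        finally show ?thesis by (simp add: minus_add)
      qed
      thus "\<exists>L. \<forall>s\<in>{u..w}. \<forall>t\<in>{u..w}. dist s t < \<eta> \<longrightarrow> d s t = - L s + L t" by blast
    qed
  next
    fix x assume "a \<le> x" "x \<le> b"
    show "\<exists>\<delta>>0. \<forall>u v. u \<le> x \<and> x \<le> v \<and> v - u < \<delta> \<longrightarrow> P u v"
    proof (intro exI[of _ \<eta>] conjI allI impI assms(2))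
      fix u v assume uv: "u \<le> x \<and> x \<le> v \<and> v - u < \<eta>"
      \<comment> \<open>All parameters in this interval are within \<open>\<eta>\<close> of each
        other, so \<open>d u\<close> itself is a potential by the cocycle identity.\<close>
      show "P u v" unfolding P_def
      proof (intro impI exI[of _ "d u"] ballI)
        fix s t assume *: "a \<le> u" "v \<le> b" "s \<in> {u..v}" "t \<in> {u..v}"
        have "d u s + d s t = d u t"
          by (rule cocycle_onD[OF assms(1)]) (use * uv in \<open>auto simp: dist_real_def\<close>)
        thus "d s t = - d u s + d u t" by (metis minus_add_cancel)
      qed
    qed
  qed
  thus ?thesis unfolding P_def lifts_def using assms(2) by blast
qed

text \<open>On short intervals both increments equal \<open>d u v\<close>, and increments add under
  concatenation. This makes the increment in \<open>holonomy\<close> independent of the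
  lift.\<close>

lemma lifts_unique:
  assumes "lifts d a b L" "lifts d a b M" "a \<le> b"
  shows "- L a + L b = - M a + M b"
proof -
  obtain \<eta> where \<eta>: "\<eta> > 0" "\<And>s t. s \<in> {a..b} \<Longrightarrow> t \<in> {a..b} \<Longrightarrow> dist s t < \<eta> \<Longrightarrow> d s t = - L s + L t"
    using assms(1) unfolding lifts_def by blast
  obtain \<mu> where \<mu>: "\<mu> > 0" "\<And>s t. s \<in> {a..b} \<Longrightarrow> t \<in> {a..b} \<Longrightarrow> dist s t < \<mu> \<Longrightarrow> d s t = - M s + M t"
    using assms(2) unfolding lifts_def by blast
  define P where "P u v \<longleftrightarrow> (a \<le> u \<longrightarrow> v \<le> b \<longrightarrow> - L u + L v = - M u + M v)" for u v
  have "P a b"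
  proof (rule Bolzano[OF assms(3)])
    fix u v w assume *: "P u v" "P v w" "u \<le> v" "v \<le> w"
    have "- L u + L w = (- L u + L v) + (- L v + L w)" by (simp add: add.assoc)
    moreover have "- M u + M w = (- M u + M v) + (- M v + M w)" by (simp add: add.assoc)
    ultimately show "P u w" using * unfolding P_def by (metis order_trans)
  next
    fix x assume "a \<le> x" "x \<le> b"
    show "\<exists>\<delta>>0. \<forall>u v. u \<le> x \<and> x \<le> v \<and> v - u < \<delta> \<longrightarrow> P u v"
    proof (intro exI[of _ "min \<eta> \<mu>"] conjI allI impI)
      fix u v assume uv: "u \<le> x \<and> x \<le> v \<and> v - u < min \<eta> \<mu>"
      show "P u v" unfolding P_def
      proof (intro impI)
        assume "a \<le> u" "v \<le> b"
        thus "- L u + L v = - M u + M v"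
          using \<eta>(2)[of u v] \<mu>(2)[of u v] uv by (auto simp: dist_real_def)
      qed
    qed (use \<eta> \<mu> in auto)
  qed
  thus ?thesis unfolding P_def by simp
qed

lemma lifts_subinterval:
  assumes "lifts d a b L" "a \<le> u" "v \<le> b"
  shows "lifts d u v L"
  using assms unfolding lifts_def by (meson atLeastAtMost_iff order_trans)

lemma lifts_reparametrise:
  assumes "lifts d a b L" "continuous_on {u..v} r" "r ` {u..v} \<subseteq> {a..b}"
    "\<And>s t. s \<in> {u..v} \<Longrightarrow> t \<in> {u..v} \<Longrightarrow> d' s t = d (r s) (r t)"
  shows "lifts d' u v (\<lambda>t. L (r t))"
proof -
  obtain \<eta> where \<eta>: "\<eta> > 0" "\<And>s t. s \<in> {a..b} \<Longrightarrow> t \<in> {a..b} \<Longrightarrow> dist s t < \<eta> \<Longrightarrow> d s t = - L s + L t"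
    using assms(1) unfolding lifts_def by blast
  obtain \<epsilon> where "\<epsilon> > 0" "\<And>s t. s \<in> {u..v} \<Longrightarrow> t \<in> {u..v} \<Longrightarrow> dist t s < \<epsilon> \<Longrightarrow> dist (r t) (r s) < \<eta>"
    using compact_uniformly_continuous[OF assms(2)] \<eta>(1) unfolding uniformly_continuous_on_def
    by (metis compact_Icc)
  thus ?thesis unfolding lifts_def using \<eta> assms(3,4)
    by (intro exI[of _ \<epsilon>]) (auto simp: image_subset_iff)
qed

section \<open>Holonomy around the two circles\<close>

definition holonomy :: "(complex \<Rightarrow> complex \<Rightarrow> 'g::group_add) \<Rightarrow> (letter \<Rightarrow> 'g) \<Rightarrow> bool" where
  "holonomy c A \<longleftrightarrow> (\<forall>x. \<exists>L. lifts (\<lambda>s t. c (gam x s) (gam x t)) 0 1 L \<and> A x = - L 0 + L 1)"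

lemma continuous_on_gam: "continuous_on S (gam x)"
  by (cases x) (auto intro!: continuous_intros)

lemma gam_in_W2 [simp]: "gam x t \<in> W2"
  by (cases x) (auto simp: W2_def)

lemma gam_0 [simp]: "gam x 0 = 0" and gam_1 [simp]: "gam x 1 = 0"
  by (cases x; simp)+

lemma holonomy_exists:
  assumes "cocycle_on (\<lambda>u. u) W2 \<delta> c" "\<delta> > 0"
  shows "\<exists>A. holonomy c A"
proof -
  have "\<exists>L. lifts (\<lambda>s t. c (gam x s) (gam x t)) 0 1 L" for x
  proof -
    obtain \<epsilon> where \<epsilon>: "\<epsilon> > 0"
      "\<And>s t. s \<in> {0..1} \<Longrightarrow> t \<in> {0..1} \<Longrightarrow> dist t s < \<epsilon> \<Longrightarrow> dist (gam x t) (gam x s) < \<delta>"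
      using compact_uniformly_continuous[OF continuous_on_gam[of "{0..1}" x]] assms(2)
      unfolding uniformly_continuous_on_def by (metis compact_Icc)
    have "cocycle_on (\<lambda>t. t) {0..1} \<epsilon> (\<lambda>s t. c (gam x s) (gam x t))"
      by (rule cocycle_on_pullback[OF assms(1)]) (use \<epsilon> in auto)
    thus ?thesis using lifts_exists \<epsilon>(1) by fastforce
  qed
  then obtain L where "\<And>x. lifts (\<lambda>s t. c (gam x s) (gam x t)) 0 1 (L x)" by metis
  thus ?thesis unfolding holonomy_def by (intro exI[of _ "\<lambda>x. - L x 0 + L x 1"]) blast
qed

definition conjugate :: "(letter \<Rightarrow> 'g::group_add) \<Rightarrow> (letter \<Rightarrow> 'g) \<Rightarrow> bool" where
  "conjugate A B \<longleftrightarrow> (\<exists>k. \<forall>x. B x = - k + A x + k)"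

text \<open>If \<open>L\<close> lifts \<open>c\<close> along a circle, then \<open>L\<close> plus
  the values of \<open>g\<close> lifts \<open>c'\<close>. Both ends of every circle are the wedge
  point, so \<open>g 0\<close> conjugates on both circles at once.\<close>

lemma cohomologous_imp_conjugate:
  assumes "cohomologous_on (\<lambda>u. u) W2 c c'" "holonomy c A" "holonomy c' A'"
  shows "conjugate A A'"
proof -
  obtain \<delta> g where \<delta>: "\<delta> > 0"
    and g: "\<And>x y. x \<in> W2 \<Longrightarrow> y \<in> W2 \<Longrightarrow> dist x y < \<delta> \<Longrightarrow> c' x y = - g x + c x y + g y"
    using assms(1) by (auto simp: cohomologous_on_def)
  have "A' x = - g 0 + A x + g 0" for x
  proof -
    obtain L where L: "lifts (\<lambda>s t. c (gam x s) (gam x t)) 0 1 L" "A x = - L 0 + L 1"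
      using assms(2) unfolding holonomy_def by blast
    obtain L' where L': "lifts (\<lambda>s t. c' (gam x s) (gam x t)) 0 1 L'" "A' x = - L' 0 + L' 1"
      using assms(3) unfolding holonomy_def by blast
    obtain \<eta> where \<eta>: "\<eta> > 0"
      "\<And>s t. s \<in> {0..1} \<Longrightarrow> t \<in> {0..1} \<Longrightarrow> dist s t < \<eta> \<Longrightarrow> c (gam x s) (gam x t) = - L s + L t"
      using L(1) unfolding lifts_def by blast
    obtain \<epsilon> where \<epsilon>: "\<epsilon> > 0"
      "\<And>s t. s \<in> {0..1} \<Longrightarrow> t \<in> {0..1} \<Longrightarrow> dist t s < \<epsilon> \<Longrightarrow> dist (gam x t) (gam x s) < \<delta>"
      using compact_uniformly_continuous[OF continuous_on_gam[of "{0..1}" x]] \<delta>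
      unfolding uniformly_continuous_on_def by (metis compact_Icc)
    have "lifts (\<lambda>s t. c' (gam x s) (gam x t)) 0 1 (\<lambda>t. L t + g (gam x t))"
      unfolding lifts_def
    proof (intro exI[of _ "min \<eta> \<epsilon>"] conjI ballI impI)
      fix s t :: real assume *: "s \<in> {0..1}" "t \<in> {0..1}" "dist s t < min \<eta> \<epsilon>"
      have "c' (gam x s) (gam x t) = - g (gam x s) + c (gam x s) (gam x t) + g (gam x t)"
        using g[of "gam x s" "gam x t"] \<epsilon>(2)[of t s] * by simp
      also have "c (gam x s) (gam x t) = - L s + L t" using \<eta>(2) * by simp
      finally show "c' (gam x s) (gam x t) = - (L s + g (gam x s)) + (L t + g (gam x t))"
        by (simp add: group_normalize del: add_uminus_conv_diff)
    qed (use \<eta> \<epsilon> in auto)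
    from lifts_unique[OF L'(1) this] show ?thesis using L L' by (simp add: group_normalize del: add_uminus_conv_diff)
  qed
  thus ?thesis unfolding conjugate_def by blast
qed

section \<open>Action of the words on pairs of group elements\<close>

lemma sum_list_conj:
  fixes k :: "'g::group_add"
  shows "sum_list (map (\<lambda>x. - k + A x + k) ws) = - k + sum_list (map A ws) + k"
  by (induction ws) (simp_all add: add.assoc)

text \<open>With \<open>A\<close> read as a homomorphism from the free group, this is its composite
  with the endomorphism spelled by \<open>word\<close>.\<close>

definition pull_word :: "sym \<Rightarrow> (letter \<Rightarrow> 'g::group_add) \<Rightarrow> letter \<Rightarrow> 'g" where
  "pull_word \<theta> A = (\<lambda>x. sum_list (map A (word \<theta> x)))"

lemma conjugate_pull_word:
  assumes "conjugate A B"
  shows "conjugate (pull_word \<theta> A) (pull_word \<theta> B)"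
proof -
  obtain k where "\<And>x. B x = - k + A x + k" using assms by (auto simp: conjugate_def)
  hence "B = (\<lambda>x. - k + A x + k)" by auto
  hence "pull_word \<theta> B x = - k + pull_word \<theta> A x + k" for x
    unfolding pull_word_def by (simp add: sum_list_conj)
  thus ?thesis unfolding conjugate_def by blast
qed

text \<open>The word of a is aab followed by the word of b, which in turn is aab followed by ab.
  Cancellation recovers aab, then ab, then a and b.\<close>

lemma pull_word_Sig_inject:
  assumes "pull_word Sig A = pull_word Sig B"
  shows "A = B"
proof -
  have a: "pull_word Sig D La = (D La + (D La + D Lb)) + pull_word Sig D Lb"
    and b: "pull_word Sig D Lb = (D La + (D La + D Lb)) + (D La + D Lb)" for D :: "letter \<Rightarrow> 'a"
    by (simp_all add: pull_word_def add.assoc)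
  have 1: "A La + (A La + A Lb) = B La + (B La + B Lb)"
    using a[of A] a[of B] assms by simp
  have 2: "A La + A Lb = B La + B Lb"
    using b[of A] b[of B] assms by (simp only: 1 add_left_cancel)
  have 3: "A La = B La" using 1 by (simp only: 2 add_right_cancel)
  have 4: "A Lb = B Lb" using 2 by (simp only: 3 add_left_cancel)
  show ?thesis by (rule ext) (metis 3 4 letter.exhaust)
qed

text \<open>The word of b is b followed by the word of a, so cancellation gives b and then
  a.\<close>

lemma pull_word_Rho_inject:
  assumes "pull_word Rho A = pull_word Rho B"
  shows "A = B"
proof -
  have a: "A Lb + A La = B Lb + B La" using fun_cong[OF assms, of La] by (simp add: pull_word_def)
  have b: "A Lb + (A Lb + A La) = B Lb + (B Lb + B La)"
    using fun_cong[OF assms, of Lb] by (simp add: pull_word_def)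
  have 3: "A Lb = B Lb" using b unfolding a by simp
  have 4: "A La = B La" using a 3 by simp
  show ?thesis by (rule ext) (metis 3 4 letter.exhaust)
qed

text \<open>Conjugation commutes with evaluating words, so it moves inside \<open>pull_word\<close>,
  where injectivity applies. This keeps classes distinct in the first family.\<close>

lemma conjugate_pull_word_cancel:
  assumes "conjugate (pull_word \<theta> A) (pull_word \<theta> B)" "\<theta> \<in> {Sig, Rho}"
  shows "conjugate A B"
proof -
  obtain k where "\<And>x. pull_word \<theta> B x = - k + pull_word \<theta> A x + k"
    using assms by (auto simp: conjugate_def)
  hence "pull_word \<theta> B = pull_word \<theta> (\<lambda>x. - k + A x + k)"
    unfolding pull_word_def sum_list_conj by auto
  hence "B = (\<lambda>x. - k + A x + k)"
    using assms(2) pull_word_Sig_inject pull_word_Rho_inject by blast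
  thus ?thesis unfolding conjugate_def by auto
qed

subsection \<open>The wedge of two circles\<close>

lemma W2_cases:
  assumes "u \<in> W2"
  obtains x t where "0 \<le> t" "t < 1" "u = gam x t"
proof -
  obtain x t where u: "u = gam x t" using assms unfolding W2_def by blast
  have "cis (2 * pi * frac t) = cis (2 * pi * t - 2 * pi * of_int \<lfloor>t\<rfloor>)"
    by (simp add: frac_def algebra_simps)
  also have "\<dots> = cis (2 * pi * t)" by (simp add: cis_divide[symmetric] cis_multiple_2pi)
  finally have "gam x (frac t) = gam x t" by (cases x) simp_all
  thus ?thesis using that[of "frac t" x] u frac_lt_1 frac_ge_0 by auto
qed

lemma compact_W2: "compact W2"
proof -
  have "W2 = gam La ` {0..1} \<union> gam Lb ` {0..1}"
  proof (rule subset_antisym; rule subsetI)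
    fix u assume "u \<in> W2"
    then obtain x t where "0 \<le> t" "t < 1" "u = gam x t" by (rule W2_cases)
    thus "u \<in> gam La ` {0..1} \<union> gam Lb ` {0..1}" by (cases x) auto
  qed (auto simp del: gam.simps)
  thus ?thesis using compact_continuous_image[OF continuous_on_gam compact_Icc] compact_Un by metis
qed

lemma positive_map_uniform:
  assumes "positive_map w f" "\<delta> > 0"
  obtains \<epsilon> where "\<epsilon> > 0" "\<And>u v. u \<in> W2 \<Longrightarrow> v \<in> W2 \<Longrightarrow> dist u v < \<epsilon> \<Longrightarrow> dist (f u) (f v) < \<delta>"
proof -
  have "continuous_on W2 f" using assms(1) by (auto simp: positive_map_def W2top_def)
  hence "uniformly_continuous_on W2 f" using compact_W2 by (rule compact_uniformly_continuous)
  thus ?thesis using assms(2) that unfolding uniformly_continuous_on_def by metis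
qed

lemma positive_map_in_W2:
  assumes "positive_map w f" "u \<in> W2"
  shows "f u \<in> W2"
  using assms unfolding positive_map_def by blast

lemma positive_map_cocycle:
  assumes "positive_map w f" "cocycle_on (\<lambda>u. u) W2 \<delta> c" "\<delta> > 0"
  obtains \<epsilon> where "\<epsilon> > 0" "cocycle_on (\<lambda>u. u) W2 \<epsilon> (\<lambda>u v. c (f u) (f v))"
proof -
  obtain \<epsilon> where "\<epsilon> > 0" "\<And>u v. u \<in> W2 \<Longrightarrow> v \<in> W2 \<Longrightarrow> dist u v < \<epsilon> \<Longrightarrow> dist (f u) (f v) < \<delta>"
    using positive_map_uniform[OF assms(1,3)] by blast
  thus ?thesis using that cocycle_on_pullback[OF assms(2), of f W2 "\<lambda>u. u" \<epsilon>]
      positive_map_in_W2[OF assms(1)] by (simp add: image_subset_iff)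
qed

text \<open>The image of circle \<open>x\<close> runs through the circles of its word in turn. On
  each piece a reparametrised lift along that circle is a lift, so the increment is the holonomy
  there, and increments add up in the order of the word.\<close>

lemma holonomy_pullback:
  assumes f: "positive_map (word \<theta>) f" and c: "cocycle_on (\<lambda>u. u) W2 \<delta> c" "\<delta> > 0"
    and A: "holonomy c A"
  shows "holonomy (\<lambda>u v. c (f u) (f v)) (pull_word \<theta> A)"
proof -
  obtain \<epsilon> where "\<epsilon> > 0" "cocycle_on (\<lambda>u. u) W2 \<epsilon> (\<lambda>u v. c (f u) (f v))"
    using positive_map_cocycle[OF f c] .
  then obtain B where B: "holonomy (\<lambda>u v. c (f u) (f v)) B" using holonomy_exists by blast
  have "B x = pull_word \<theta> A x" for x
  proof -
    let ?w = "word \<theta> x" and ?d = "\<lambda>s t. c (f (gam x s)) (f (gam x t))"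
    obtain L where L: "lifts ?d 0 1 L" "B x = - L 0 + L 1"
      using B unfolding holonomy_def by blast
    obtain t :: "nat \<Rightarrow> real" where t: "t 0 = 0" "t (length ?w) = 1"
      "\<And>j. j < length ?w \<Longrightarrow> t j < t (Suc j) \<and>
           (\<exists>u. continuous_on {t j..t (Suc j)} u \<and> strict_mono_on {t j..t (Suc j)} u \<and>
                u (t j) = 0 \<and> u (t (Suc j)) = 1 \<and>
                (\<forall>s\<in>{t j..t (Suc j)}. f (gam x s) = gam (?w ! j) (u s)))"
      using f unfolding positive_map_def by blast
    have less: "t j < t (Suc j)" if "j < length ?w" for j using t(3)[OF that] ..
    have t0: "0 \<le> t j" if "j \<le> length ?w" for j
      using that
    proof (induction j)
      case (Suc j)
      thus ?case using less[of j] by simp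
    qed (simp add: t(1))
    have t1: "t j \<le> 1" if "j \<le> length ?w" for j
      using that
    proof (induction rule: inc_induct)
      case (step j)
      thus ?case using less[of j] by simp
    qed (simp add: t(2))
    have step: "- L (t j) + L (t (Suc j)) = A (?w ! j)" if j: "j < length ?w" for j
    proof -
      obtain u where u: "continuous_on {t j..t (Suc j)} u" "strict_mono_on {t j..t (Suc j)} u"
        "u (t j) = 0" "u (t (Suc j)) = 1"
        "\<And>s. s \<in> {t j..t (Suc j)} \<Longrightarrow> f (gam x s) = gam (?w ! j) (u s)"
        and tj: "t j < t (Suc j)"
        using t(3)[OF j] by blast
      obtain M where M: "lifts (\<lambda>s t. c (gam (?w ! j) s) (gam (?w ! j) t)) 0 1 M"
        "A (?w ! j) = - M 0 + M 1"
        using A unfolding holonomy_def by blast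
      \<comment> \<open>\<open>M\<close> is a lift for parameters from 0 to 1; monotonicity keeps
        \<open>u\<close> in that range.\<close>
      have r: "u ` {t j..t (Suc j)} \<subseteq> {0..1}"
      proof (rule image_subsetI)
        fix s assume s: "s \<in> {t j..t (Suc j)}"
        have "u (t j) \<le> u s" "u s \<le> u (t (Suc j))"
          using s tj by (auto intro!: strict_mono_on_leD[OF u(2)])
        thus "u s \<in> {0..1}" using u(3,4) by simp
      qed
      have "lifts ?d (t j) (t (Suc j)) (\<lambda>s. M (u s))"
        by (rule lifts_reparametrise[OF M(1) u(1) r]) (simp add: u(5))
      moreover have "lifts ?d (t j) (t (Suc j)) L"
        by (rule lifts_subinterval[OF L(1)]) (use t0[of j] t1[of "Suc j"] j in auto)
      ultimately have "- L (t j) + L (t (Suc j)) = - M (u (t j)) + M (u (t (Suc j)))"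
        using lifts_unique[of ?d "t j" "t (Suc j)" L "\<lambda>s. M (u s)"] tj by simp
      thus ?thesis using M(2) u(3,4) by simp
    qed
    \<comment> \<open>The increments over the first \<open>n\<close> pieces telescope.\<close>
    have "- L (t 0) + L (t n) = sum_list (map A (take n ?w))" if "n \<le> length ?w" for n
      using that
    proof (induction n)
      case (Suc n)
      have "- L (t 0) + L (t (Suc n)) = (- L (t 0) + L (t n)) + (- L (t n) + L (t (Suc n)))"
        by (simp add: add.assoc)
      also have "\<dots> = sum_list (map A (take n ?w)) + A (?w ! n)"
        using Suc step[of n] by simp
      finally show ?case using Suc.prems by (simp add: take_Suc_conv_app_nth)
    qed simp
    from this[of "length ?w"] show ?thesis using t(1,2) L(2) by (simp add: pull_word_def)
  qed
  hence "B = pull_word \<theta> A" by blast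
  thus ?thesis using B by simp
qed

section \<open>Metric geometry of the wedge\<close>

lemma dist_gam: "dist (gam x s) (gam x t) = 2 * \<bar>sin (pi * (s - t))\<bar>"
proof -
  have "dist (gam x s) (gam x t) = cmod (cis (2 * pi * s) - cis (2 * pi * t))"
    by (cases x) (auto simp: dist_norm norm_minus_commute)
  also have "cis (2 * pi * s) - cis (2 * pi * t) = cis (2 * pi * t) * (cis (2 * pi * (s - t)) - 1)"
    by (simp add: right_diff_distrib cis_mult)
  also have "cmod \<dots> = dist (exp (\<i> * of_real (2 * pi * (s - t)))) 1"
    by (simp add: norm_mult dist_norm cis_conv_exp)
  also have "\<dots> = 2 * \<bar>sin (pi * (s - t))\<bar>"
    unfolding dist_norm by (subst dist_exp_i_1) (simp add: mult.assoc)
  finally show ?thesis .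
qed

text \<open>By \<open>dist_gam\<close> chord length is a sine, which between \<open>\<eta>\<close>
  and \<open>1 - \<eta>\<close> is at least its value at the ends. A short chord thus means close
  parameters up to a full turn.\<close>

lemma gam_near:
  assumes "s \<in> {0..1}" "t \<in> {0..1}" "0 < \<eta>" "\<eta> \<le> 1/2" "dist (gam x s) (gam x t) < 2 * sin (pi * \<eta>)"
  shows "\<bar>s - t\<bar> < \<eta> \<or> \<bar>s - t\<bar> > 1 - \<eta>"
proof (rule ccontr)
  define r where "r = \<bar>s - t\<bar>"
  assume "\<not> (\<bar>s - t\<bar> < \<eta> \<or> \<bar>s - t\<bar> > 1 - \<eta>)"
  hence r: "\<eta> \<le> r" "r \<le> 1 - \<eta>" by (auto simp: r_def)
  have mono: "sin (pi * \<eta>) \<le> sin (pi * q)" if "\<eta> \<le> q" "q \<le> 1/2" for q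
    using that assms(3) by (intro sin_monotone_2pi_le) (auto intro: order_trans[of _ 0])
  have "sin (pi * \<eta>) \<le> sin (pi * r)"
  proof (cases "r \<le> 1/2")
    case True thus ?thesis using mono r by blast
  next
    case False
    hence "sin (pi * \<eta>) \<le> sin (pi * (1 - r))" using mono[of "1 - r"] r by simp
    also have "sin (pi * (1 - r)) = sin (pi * r)" by (simp add: right_diff_distrib)
    finally show ?thesis .
  qed
  also have "\<dots> \<le> \<bar>sin (pi * (s - t))\<bar>"
  proof (cases "s \<le> t")
    case True
    hence "pi * (s - t) = - (pi * r)" by (simp add: r_def algebra_simps)
    thus ?thesis by (simp only: sin_minus abs_minus_cancel abs_ge_self)
  qed (simp add: r_def)
  finally show False using assms(5) by (simp add: dist_gam)
qed

text \<open>This merges the equations of the unit circles about -1 and 1. A small real part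
  therefore forces a point to be close to the wedge point.\<close>

lemma norm_W2:
  assumes "u \<in> W2"
  shows "(Re u)\<^sup>2 + (Im u)\<^sup>2 = 2 * \<bar>Re u\<bar>"
proof -
  obtain x t where "u = gam x t" using assms unfolding W2_def by blast
  thus ?thesis
  proof -
    have sq: "(Re u)\<^sup>2 + (Im u)\<^sup>2 = 2 * (1 - cos (2 * pi * t))"
      using sin_cos_squared_add[of "2 * pi * t"] \<open>u = gam x t\<close> by (cases x) (auto simp: power2_diff)
    have "Re u = cos (2 * pi * t) - 1 \<or> Re u = 1 - cos (2 * pi * t)"
      using \<open>u = gam x t\<close> by (cases x) auto
    hence "\<bar>Re u\<bar> = 1 - cos (2 * pi * t)" using cos_le_one[of "2 * pi * t"] by linarith
    thus ?thesis using sq by simp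
  qed
qed

lemma Re_gam: "Re (gam La t) \<le> 0" "Re (gam Lb t) \<ge> 0"
  by auto

text \<open>Parameters are compared in the closed unit interval and not modulo 1, because lifts are
  controlled only there. Points just after 0 and just before 1 are linked through the wedge point
  instead.\<close>

definition near :: "real \<Rightarrow> complex \<Rightarrow> complex \<Rightarrow> bool" where
  "near \<eta> u v \<longleftrightarrow> (\<exists>x. \<exists>s\<in>{0..1}. \<exists>t\<in>{0..1}. dist s t < \<eta> \<and> u = gam x s \<and> v = gam x t)"

lemma near_sym: "near \<eta> u v \<Longrightarrow> near \<eta> v u"
  unfolding near_def by (metis dist_commute)

lemma near_gam:
  assumes "s \<in> {0..1}" "t \<in> {0..1}" "0 < \<eta>" "\<eta> \<le> 1/2" "dist (gam x s) (gam x t) < 2 * sin (pi * \<eta>)"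
  shows "near \<eta> (gam x s) (gam x t) \<or> near \<eta> (gam x s) 0 \<and> near \<eta> 0 (gam x t)"
proof -
  have endpoint: "near \<eta> (gam x r) 0" if "r \<in> {0..1}" "r < \<eta> \<or> r > 1 - \<eta>" for r
  proof (cases "r < \<eta>")
    case True
    show ?thesis unfolding near_def
      by (intro exI[of _ x] bexI[of _ r] bexI[of _ 0]) (use True that in \<open>auto simp: dist_real_def\<close>)
  next
    case False
    show ?thesis unfolding near_def
      by (intro exI[of _ x] bexI[of _ r] bexI[of _ 1]) (use False that in \<open>auto simp: dist_real_def\<close>)
  qed
  consider "\<bar>s - t\<bar> < \<eta>" | "\<bar>s - t\<bar> > 1 - \<eta>" using gam_near[OF assms] by blast
  thus ?thesis
  proof cases
    case 1
    thus ?thesis using assms(1,2) unfolding near_def dist_real_def by blast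
  next
    case 2
    hence "s < \<eta> \<or> s > 1 - \<eta>" "t < \<eta> \<or> t > 1 - \<eta>" using assms(1-3) by auto
    thus ?thesis using endpoint near_sym assms(1,2) by blast
  qed
qed

lemma near_zero:
  assumes "u \<in> W2" "0 < \<eta>" "\<eta> \<le> 1/2" "cmod u < 2 * sin (pi * \<eta>)"
  shows "near \<eta> u 0"
proof -
  obtain x t where t: "0 \<le> t" "t < 1" "u = gam x t" using assms(1) by (rule W2_cases)
  have "near \<eta> (gam x t) (gam x 0) \<or> near \<eta> (gam x t) 0 \<and> near \<eta> 0 (gam x 0)"
    by (rule near_gam) (use t assms in auto)
  thus ?thesis using t by auto
qed

text \<open>On different circles the real parts have opposite signs, so both are bounded by the
  distance, and \<open>norm_W2\<close> puts both points close to the wedge point. Points on one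
  circle fall under \<open>near_gam\<close>.\<close>

lemma W2_near:
  assumes "0 < \<eta>" "\<eta> \<le> 1/2"
  obtains \<delta> where "\<delta> > 0" "\<And>u v. u \<in> W2 \<Longrightarrow> v \<in> W2 \<Longrightarrow> dist u v < \<delta> \<Longrightarrow>
    near \<eta> u v \<or> near \<eta> u 0 \<and> near \<eta> 0 v"
proof -
  define q where "q = 2 * sin (pi * \<eta>)"
  have q: "q > 0" unfolding q_def using assms by (auto intro!: sin_gt_zero)
  have two: "near \<eta> u 0 \<and> near \<eta> v 0"
    if uv: "u \<in> W2" "v \<in> W2" "Re u \<le> 0" "Re v \<ge> 0" "dist u v < q\<^sup>2 / 2" for u v
  proof -
    have "Re v - Re u \<le> dist u v" unfolding dist_norm
      using complex_Re_le_cmod[of "v - u"] by (simp add: norm_minus_commute)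
    moreover have "(cmod u)\<^sup>2 = 2 * \<bar>Re u\<bar>" "(cmod v)\<^sup>2 = 2 * \<bar>Re v\<bar>"
      using norm_W2 uv(1,2) by (simp_all add: cmod_power2)
    ultimately have "(cmod u)\<^sup>2 < q\<^sup>2" "(cmod v)\<^sup>2 < q\<^sup>2" using uv(3-5) by linarith+
    hence "cmod u < q" "cmod v < q" using q by (meson power2_less_imp_less less_imp_le)+
    thus ?thesis using near_zero uv(1,2) assms unfolding q_def by blast
  qed
  show ?thesis
  proof (rule that[of "min q (q\<^sup>2 / 2)"])
    fix u v assume uv: "u \<in> W2" "v \<in> W2" "dist u v < min q (q\<^sup>2 / 2)"
    obtain x s where s: "0 \<le> s" "s < 1" "u = gam x s" using uv(1) by (rule W2_cases)
    obtain y t where t: "0 \<le> t" "t < 1" "v = gam y t" using uv(2) by (rule W2_cases)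
    consider "x = y" | "x = La" "y = Lb" | "x = Lb" "y = La" by (cases x; cases y) auto
    thus "near \<eta> u v \<or> near \<eta> u 0 \<and> near \<eta> 0 v"
    proof cases
      case 1
      thus ?thesis using near_gam[of s t \<eta> x] s t uv assms unfolding q_def by auto
    next
      case 2
      thus ?thesis using two[of u v] s t uv Re_gam near_sym by auto
    next
      case 3
      thus ?thesis using two[of v u] s t uv Re_gam near_sym by (auto simp: dist_commute)
    qed
  qed (use q in auto)
qed

lemma gam_eqD:
  assumes "gam x s = gam y t" "s \<in> {0..1}" "t \<in> {0..1}"
  shows "x = y \<and> s = t \<or> s \<in> {0,1} \<and> t \<in> {0,1}"
proof -
  have same: "s = t \<or> s \<in> {0,1} \<and> t \<in> {0,1}"
    if "gam x s = gam x t" "s \<in> {0..1}" "t \<in> {0..1}" for x s t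
  proof (rule ccontr)
    assume no: "\<not> ?thesis"
    \<comment> \<open>For this value both alternatives of \<open>gam_near\<close> fail, although the
      chord has length 0.\<close>
    define \<eta> where "\<eta> = min \<bar>s - t\<bar> (1 - \<bar>s - t\<bar>)"
    have \<eta>: "0 < \<eta>" "\<eta> \<le> 1/2" using no that(2,3) by (auto simp: \<eta>_def min_def abs_if split: if_splits)
    hence "0 < sin (pi * \<eta>)" by (auto intro!: sin_gt_zero)
    hence "\<bar>s - t\<bar> < \<eta> \<or> \<bar>s - t\<bar> > 1 - \<eta>"
      using gam_near[OF that(2,3) \<eta>, of x] that(1) by simp
    thus False by (auto simp: \<eta>_def)
  qed
  show ?thesis
  proof (cases "x = y")
    case True thus ?thesis using same assms by blast
  next
    case False
    have "Re (gam x s) = 0" using False assms(1) Re_gam[of s] Re_gam[of t]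
      by (cases x; cases y) (simp_all del: gam.simps)
    hence z: "gam x s = 0" using norm_W2[of "gam x s"] by (simp add: complex_eq_iff del: gam.simps)
    hence "gam x s = gam x 0" "gam y t = gam y 0" using assms(1) by (simp_all del: gam.simps)
    thus ?thesis using same[of x s 0] same[of y t 0] assms(2,3) by auto
  qed
qed

text \<open>Together with \<open>cohomologous_imp_conjugate\<close>, holonomy up to conjugacy
  classifies cocycles on the wedge. Pairs that are close only across the wedge point are reduced to
  pairs with that point by the cocycle identity.\<close>

lemma conjugate_imp_cohomologous:
  assumes c: "cocycle_on (\<lambda>u. u) W2 \<delta> c" "\<delta> > 0" and c': "cocycle_on (\<lambda>u. u) W2 \<delta>' c'" "\<delta>' > 0"
    and "holonomy c A" "holonomy c' A'" "conjugate A A'"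
  shows "cohomologous_on (\<lambda>u. u) W2 c c'"
proof -
  obtain k where k: "\<And>x. A' x = - k + A x + k" using assms(7) unfolding conjugate_def by blast
  obtain L where L: "\<And>x. lifts (\<lambda>s t. c (gam x s) (gam x t)) 0 1 (L x)" "\<And>x. A x = - L x 0 + L x 1"
    using assms(5) unfolding holonomy_def by metis
  obtain L' where L': "\<And>x. lifts (\<lambda>s t. c' (gam x s) (gam x t)) 0 1 (L' x)" "\<And>x. A' x = - L' x 0 + L' x 1"
    using assms(6) unfolding holonomy_def by metis
  \<comment> \<open>The coboundary must have this form along each circle, with value \<open>k\<close> at the wedge point;
    conjugacy of the holonomies makes it close up.\<close>
  define h where "h x t = - L x t + L x 0 + k + (- L' x 0 + L' x t)" for x t
  have h0: "h x 0 = k" for x by (simp add: h_def)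
  have h1: "h x 1 = k" for x
  proof -
    have "h x 1 = - A x + k + A' x" by (simp add: h_def L(2) L'(2) minus_add)
    thus ?thesis unfolding k by (simp add: group_normalize del: add_uminus_conv_diff)
  qed
  \<comment> \<open>A point with two descriptions is the wedge point, where every value of
    \<open>h\<close> is \<open>k\<close>; hence the description is unique.\<close>
  define g where "g u = (THE z. \<exists>x. \<exists>t\<in>{0..1}. u = gam x t \<and> z = h x t)" for u
  have g: "g (gam x t) = h x t" if t: "t \<in> {0..1}" for x t
    unfolding g_def
  proof (rule the_equality)
    show "\<exists>y. \<exists>r\<in>{0..1}. gam x t = gam y r \<and> h x t = h y r" using t by blast
  next
    fix z assume "\<exists>y. \<exists>r\<in>{0..1}. gam x t = gam y r \<and> z = h y r"
    then obtain y r where "r \<in> {0..1}" "gam x t = gam y r" "z = h y r" by blast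
    thus "z = h x t" using gam_eqD[of x t y r] t h0 h1 by auto
  qed
  \<comment> \<open>The distance bound is carried along so that both cocycle identities apply to
    these pairs later.\<close>
  have "\<exists>\<eta>>0. \<eta> \<le> 1/2 \<and> (\<forall>s\<in>{0..1}. \<forall>t\<in>{0..1}. dist s t < \<eta> \<longrightarrow>
      c' (gam x s) (gam x t) = - g (gam x s) + c (gam x s) (gam x t) + g (gam x t) \<and>
      dist (gam x s) (gam x t) < min \<delta> \<delta>')" for x
  proof -
    obtain \<eta> where \<eta>: "\<eta> > 0"
      "\<And>s t. s \<in> {0..1} \<Longrightarrow> t \<in> {0..1} \<Longrightarrow> dist s t < \<eta> \<Longrightarrow> c (gam x s) (gam x t) = - L x s + L x t"
      using L(1)[of x] unfolding lifts_def by blast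
    obtain \<eta>' where \<eta>': "\<eta>' > 0"
      "\<And>s t. s \<in> {0..1} \<Longrightarrow> t \<in> {0..1} \<Longrightarrow> dist s t < \<eta>' \<Longrightarrow> c' (gam x s) (gam x t) = - L' x s + L' x t"
      using L'(1)[of x] unfolding lifts_def by blast
    obtain \<epsilon> where \<epsilon>: "\<epsilon> > 0"
      "\<And>s t. s \<in> {0..1} \<Longrightarrow> t \<in> {0..1} \<Longrightarrow> dist t s < \<epsilon> \<Longrightarrow> dist (gam x t) (gam x s) < min \<delta> \<delta>'"
      using compact_uniformly_continuous[OF continuous_on_gam[of "{0..1}" x]] c(2) c'(2)
      unfolding uniformly_continuous_on_def by (metis compact_Icc min_less_iff_conj)
    show ?thesis
    proof (intro exI[of _ "min (min \<eta> \<eta>') (min \<epsilon> (1/2))"] conjI ballI impI)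
      fix s t :: real assume st: "s \<in> {0..1}" "t \<in> {0..1}" "dist s t < min (min \<eta> \<eta>') (min \<epsilon> (1/2))"
      have "- g (gam x s) + c (gam x s) (gam x t) + g (gam x t) = - h x s + (- L x s + L x t) + h x t"
        using \<eta>(2) g st by simp
      also have "\<dots> = - L' x s + L' x t"
        by (simp add: h_def group_normalize del: add_uminus_conv_diff)
      also have "\<dots> = c' (gam x s) (gam x t)" using \<eta>'(2) st by simp
      finally show "c' (gam x s) (gam x t) = - g (gam x s) + c (gam x s) (gam x t) + g (gam x t)" ..
      show "dist (gam x s) (gam x t) < min \<delta> \<delta>'" using \<epsilon>(2)[of t s] st by simp
    qed (use \<eta> \<eta>' \<epsilon> in auto)
  qed
  then obtain \<eta> where \<eta>: "\<And>x. \<eta> x > 0" "\<And>x. \<eta> x \<le> 1/2"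
    "\<And>x s t. s \<in> {0..1} \<Longrightarrow> t \<in> {0..1} \<Longrightarrow> dist s t < \<eta> x \<Longrightarrow>
      c' (gam x s) (gam x t) = - g (gam x s) + c (gam x s) (gam x t) + g (gam x t) \<and>
      dist (gam x s) (gam x t) < min \<delta> \<delta>'"
    by metis
  define \<mu> where "\<mu> = min (\<eta> La) (\<eta> Lb)"
  have \<mu>: "0 < \<mu>" "\<mu> \<le> 1/2" "\<mu> \<le> \<eta> x" for x using \<eta>(1,2) by (cases x; auto simp: \<mu>_def min_def)+
  have near: "c' u v = - g u + c u v + g v \<and> dist u v < min \<delta> \<delta>'" if uv: "near \<mu> u v" for u v
  proof -
    obtain x s t where st: "s \<in> {0..1}" "t \<in> {0..1}" "dist s t < \<mu>" "u = gam x s" "v = gam x t"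
      using uv unfolding near_def by blast
    have "dist s t < \<eta> x" using st(3) \<mu>(3)[of x] by simp
    thus ?thesis using \<eta>(3) st by blast
  qed
  obtain \<kappa> where \<kappa>: "\<kappa> > 0" "\<And>u v. u \<in> W2 \<Longrightarrow> v \<in> W2 \<Longrightarrow> dist u v < \<kappa> \<Longrightarrow>
      near \<mu> u v \<or> near \<mu> u 0 \<and> near \<mu> 0 v"
    using W2_near[OF \<mu>(1,2)] by blast
  have W0: "0 \<in> W2" using gam_in_W2[of La 0] by simp
  show ?thesis unfolding cohomologous_on_def
  proof (intro exI[of _ "min \<kappa> (min \<delta> \<delta>')"] conjI exI[of _ g] ballI impI)
    fix u v assume uv: "u \<in> W2" "v \<in> W2" "dist u v < min \<kappa> (min \<delta> \<delta>')"
    consider "near \<mu> u v" | "near \<mu> u 0" "near \<mu> 0 v" using \<kappa>(2) uv by auto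
    thus "c' u v = - g u + c u v + g v"
    proof cases
      case 1 thus ?thesis using near by blast
    next
      case 2
      note n = near[OF 2(1)] near[OF 2(2)]
      have "c' u v = c' u 0 + c' 0 v"
        by (rule cocycle_onD[OF c'(1), symmetric]) (use uv n W0 in auto)
      also have "\<dots> = - g u + (c u 0 + c 0 v) + g v"
        using n by (simp add: group_normalize del: add_uminus_conv_diff)
      also have "c u 0 + c 0 v = c u v"
        by (rule cocycle_onD[OF c(1)]) (use uv n W0 in auto)
      finally show ?thesis .
    qed
  qed (use \<kappa> c c' in auto)
qed

section \<open>A cocycle with prescribed holonomy\<close>

text \<open>The lift of \<open>wedge_cocycle A\<close> along circle \<open>x\<close> jumps by \<open>A x\<close> on arrival at the wedge point.
  Near that point \<open>branch\<close> is the amount still to be picked up, which is \<open>A x\<close> on the final half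
  of circle \<open>x\<close>.\<close>

definition branch :: "(letter \<Rightarrow> 'g::group_add) \<Rightarrow> complex \<Rightarrow> 'g" where
  "branch A u = (if Re u < 0 \<and> Im u < 0 then A La else if Re u > 0 \<and> Im u > 0 then A Lb else 0)"

definition wedge_cocycle :: "(letter \<Rightarrow> 'g::group_add) \<Rightarrow> complex \<Rightarrow> complex \<Rightarrow> 'g" where
  "wedge_cocycle A u v = (if cmod u < 1 \<or> cmod v < 1 then branch A u - branch A v else 0)"

lemma branch_gam:
  assumes "t \<in> {0..1}"
  shows "branch A (gam x t) = (if 1/2 < t \<and> t < 1 then A x else 0)"
proof (cases "1/2 < t \<and> t < 1")
  case True
  hence "pi < 2 * pi * t" "2 * pi * t < 2 * pi" by (simp_all add: field_simps)
  hence s: "sin (2 * pi * t) < 0" by (rule sin_lt_zero)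
  have "cos (2 * pi * t) \<noteq> 1"
  proof
    assume "cos (2 * pi * t) = 1"
    thus False using s sin_cos_squared_add[of "2 * pi * t"] by simp
  qed
  hence "cos (2 * pi * t) < 1" using cos_le_one[of "2 * pi * t"] by linarith
  thus ?thesis using s True by (cases x) (simp_all add: branch_def)
next
  case False
  have "sin (2 * pi * t) \<ge> 0"
  proof (cases "t \<le> 1/2")
    case True
    have "t * 2 \<le> 1" using True by simp
    hence "pi * (t * 2) \<le> pi * 1" by (intro mult_left_mono) auto
    thus ?thesis using assms by (intro sin_ge_zero) (auto simp: mult_ac)
  next
    case b: False
    hence "t = 1" using False assms by auto
    thus ?thesis by simp
  qed
  thus ?thesis using False by (cases x) (auto simp: branch_def leD[OF cos_le_one])
qed

text \<open>Between radius 1 and 3/2 the real parts are at least 1/2 and the imaginary parts above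
  1/2 in absolute value. Points closer than 1/2 then share a quadrant, so the two clauses of
  \<open>wedge_cocycle\<close> fit together.\<close>

lemma branch_locally_constant:
  assumes "u \<in> W2" "v \<in> W2" "1 \<le> cmod u" "cmod u < 3/2" "1 \<le> cmod v" "cmod v < 3/2" "dist u v < 1/2"
  shows "branch A u = branch A v"
proof -
  have ReIm: "1/2 \<le> \<bar>Re w\<bar> \<and> 1/2 < \<bar>Im w\<bar>" if w: "w \<in> W2" "1 \<le> cmod w" "cmod w < 3/2" for w
  proof -
    have n: "(cmod w)\<^sup>2 = 2 * \<bar>Re w\<bar>" using norm_W2[OF w(1)] by (simp add: cmod_power2)
    have "1 \<le> (cmod w)\<^sup>2" using w(2) by simp
    hence 1: "1/2 \<le> \<bar>Re w\<bar>" using n by simp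
    have "(cmod w)\<^sup>2 < (3/2)\<^sup>2" using w(3) by (intro power_strict_mono) auto
    hence 2: "\<bar>Re w\<bar> < 9/8" unfolding n by (simp add: power2_eq_square)
    \<comment> \<open>This product bounds the square of the real part linearly, and
      \<open>norm_W2\<close> turns that into a lower bound for the imaginary part.\<close>
    have "0 \<le> (\<bar>Re w\<bar> - 1/2) * (9/8 - \<bar>Re w\<bar>)" using 1 2 by simp
    also have "\<dots> = 13/8 * \<bar>Re w\<bar> - 9/16 - \<bar>Re w\<bar>\<^sup>2"
      by (simp add: field_simps power2_eq_square del: abs_mult_self_eq)
    finally have "(Im w)\<^sup>2 \<ge> 3/8 * \<bar>Re w\<bar> + 9/16" using norm_W2[OF w(1)] by simp
    hence "(1/2)\<^sup>2 < \<bar>Im w\<bar>\<^sup>2" by (simp add: power2_eq_square)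
    hence "1/2 < \<bar>Im w\<bar>" using power2_less_imp_less[of "1/2" "\<bar>Im w\<bar>"] by simp
    thus ?thesis using 1 by blast
  qed
  have "\<bar>Re u - Re v\<bar> < 1/2" "\<bar>Im u - Im v\<bar> < 1/2"
    using assms(7) abs_Re_le_cmod[of "u - v"] abs_Im_le_cmod[of "u - v"] by (simp_all add: dist_norm)
  thus ?thesis using ReIm[OF assms(1,3,4)] ReIm[OF assms(2,5,6)] unfolding branch_def
    by (simp add: abs_if split: if_splits)
qed

lemma wedge_cocycle_near:
  assumes "u \<in> W2" "v \<in> W2" "cmod u < 3/2" "cmod v < 3/2" "dist u v < 1/2"
  shows "wedge_cocycle A u v = branch A u - branch A v"
  using branch_locally_constant[of u v A] assms by (auto simp: wedge_cocycle_def)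

text \<open>If one of the three points has norm below 1, all have norm below 3/2, where the cocycle
  is a difference of values of \<open>branch\<close>. Otherwise all three values vanish.\<close>

lemma cocycle_on_wedge_cocycle: "cocycle_on (\<lambda>u. u) W2 (1/2) (wedge_cocycle A)"
  unfolding cocycle_on_def
proof (intro ballI impI)
  fix u v w assume *: "u \<in> W2" "v \<in> W2" "w \<in> W2" "dist u v < 1/2" "dist v w < 1/2" "dist u w < 1/2"
  show "wedge_cocycle A u v + wedge_cocycle A v w = wedge_cocycle A u w"
  proof (cases "cmod u < 1 \<or> cmod v < 1 \<or> cmod w < 1")
    case True
    have close: "cmod p < cmod q + 1/2" if "dist p q < 1/2" for p q
      using norm_triangle_ineq[of "p - q" q] that by (simp add: dist_norm)
    have "cmod u < 3/2 \<and> cmod v < 3/2 \<and> cmod w < 3/2"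
      using True *(4-6) close[of u v] close[of v u] close[of v w] close[of w v] close[of u w]
        close[of w u] dist_commute[of u v] dist_commute[of v w] dist_commute[of u w] by linarith
    thus ?thesis using * by (simp add: wedge_cocycle_near group_normalize del: add_uminus_conv_diff)
  qed (simp add: wedge_cocycle_def)
qed

lemma holonomy_wedge_cocycle: "holonomy (wedge_cocycle A) A"
  unfolding holonomy_def
proof (intro allI exI conjI)
  fix x
  let ?L = "\<lambda>t::real. if t < 1 then 0 else A x"
  show "A x = - ?L 0 + ?L 1" by simp
  show "lifts (\<lambda>s t. wedge_cocycle A (gam x s) (gam x t)) 0 1 ?L"
    unfolding lifts_def
  \<comment> \<open>Norm below 1 forces a parameter below 1/6 or above 5/6, since the sine of 30
    degrees is 1/2. At this scale a pair containing such a parameter stays in one half of the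
    circle.\<close>
  proof (intro exI[of _ "1/6"] conjI ballI impI)
    fix s t :: real assume st: "s \<in> {0..1}" "t \<in> {0..1}" "dist s t < 1/6"
    have close: "r < 1/6 \<or> r > 5/6" if "cmod (gam x r) < 1" "r \<in> {0..1}" for r
      using gam_near[of r 0 "1/6" x] that by (simp add: sin_30 del: gam.simps)
    show "wedge_cocycle A (gam x s) (gam x t) = - ?L s + ?L t"
    proof (cases "cmod (gam x s) < 1 \<or> cmod (gam x t) < 1")
      case True
      hence "wedge_cocycle A (gam x s) (gam x t) =
          (if 1/2 < s \<and> s < 1 then A x else 0) - (if 1/2 < t \<and> t < 1 then A x else 0)"
        using st by (simp add: wedge_cocycle_def branch_gam del: gam.simps)
      moreover have "s < 1/6 \<or> s > 5/6 \<or> t < 1/6 \<or> t > 5/6" using True close st by blast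
      hence "s \<le> 1/2 \<and> t \<le> 1/2 \<or> 1/2 < s \<and> 1/2 < t"
        using st(3) unfolding dist_real_def by linarith
      ultimately show ?thesis using st(1,2) by auto
    next
      case False
      hence "s \<noteq> 1" "t \<noteq> 1" by (auto simp del: gam.simps)
      hence "s < 1" "t < 1" using st by auto
      thus ?thesis using False by (simp add: wedge_cocycle_def del: gam.simps)
    qed
  qed simp
qed

subsection \<open>Passage between the levels of an expansion\<close>

lemma continuous_map_dist_pair:
  fixes p :: "'a \<Rightarrow> 'm::metric_space"
  assumes "continuous_map X euclidean p"
  shows "continuous_map (prod_topology X X) euclideanreal (\<lambda>z. dist (p (fst z)) (p (snd z)))"
proof -
  have "continuous_map (prod_topology X X) (prod_topology euclidean euclidean) (\<lambda>z. (p (fst z), p (snd z)))"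
    using continuous_map_compose[OF continuous_map_fst assms] continuous_map_compose[OF continuous_map_snd assms]
    by (intro continuous_map_pairedI) (simp_all add: o_def)
  hence 1: "continuous_map (prod_topology X X) euclidean (\<lambda>z. (p (fst z), p (snd z)))" by simp
  have "continuous_on UNIV (\<lambda>w::'m \<times> 'm. dist (fst w) (snd w))" by (intro continuous_intros)
  hence 2: "continuous_map euclidean euclideanreal (\<lambda>w::'m \<times> 'm. dist (fst w) (snd w))" by simp
  show ?thesis using continuous_map_compose[OF 1 2] by (simp add: o_def)
qed

text \<open>Otherwise compactness would yield two points with equal projections at all levels whose
  images under \<open>\<phi>\<close> are at least \<open>\<delta>\<close> apart.\<close>

lemma compact_tower_uniform:
  fixes p :: "nat \<Rightarrow> 'a \<Rightarrow> 'm::metric_space" and \<phi> :: "'a \<Rightarrow> 'n::metric_space"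
  assumes X: "compact_space X" and p: "\<And>n. continuous_map X euclidean (p n)"
    and \<phi>: "continuous_map X euclidean \<phi>"
    and inj: "\<And>x y. x \<in> topspace X \<Longrightarrow> y \<in> topspace X \<Longrightarrow> (\<And>n. p n x = p n y) \<Longrightarrow> \<phi> x = \<phi> y"
    and mono: "\<And>n m \<delta>. n \<le> m \<Longrightarrow> \<delta> > 0 \<Longrightarrow>
      \<exists>\<epsilon>>0. \<forall>x\<in>topspace X. \<forall>y\<in>topspace X. dist (p m x) (p m y) < \<epsilon> \<longrightarrow> dist (p n x) (p n y) < \<delta>"
    and \<delta>: "\<delta> > 0"
  shows "\<exists>N. \<forall>m\<ge>N. \<exists>\<epsilon>>0. \<forall>x\<in>topspace X. \<forall>y\<in>topspace X.
    dist (p m x) (p m y) < \<epsilon> \<longrightarrow> dist (\<phi> x) (\<phi> y) < \<delta>"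
proof -
  define XX where "XX = prod_topology X X"
  \<comment> \<open>The bad pairs: images far apart despite near agreement at all levels up to
    \<open>k\<close>.\<close>
  define C where "C k = {z \<in> topspace XX. \<delta> \<le> dist (\<phi> (fst z)) (\<phi> (snd z))} \<inter>
    (\<Inter>n\<le>k. {z \<in> topspace XX. dist (p n (fst z)) (p n (snd z)) \<le> inverse (real (Suc k))})" for k
  have C: "(x, y) \<in> C k \<longleftrightarrow> x \<in> topspace X \<and> y \<in> topspace X \<and> \<delta> \<le> dist (\<phi> x) (\<phi> y) \<and>
      (\<forall>n\<le>k. dist (p n x) (p n y) \<le> inverse (real (Suc k)))" for x y k
    unfolding C_def XX_def by (simp del: of_nat_Suc) blast
  have "closedin XX (C k)" for k
  proof -
    have "closedin XX {z \<in> topspace XX. dist (\<phi> (fst z)) (\<phi> (snd z)) \<in> {\<delta>..}}"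
      unfolding XX_def by (rule closedin_continuous_map_preimage[OF continuous_map_dist_pair[OF \<phi>]]) auto
    moreover have "closedin XX {z \<in> topspace XX. dist (p n (fst z)) (p n (snd z)) \<in> {..inverse (real (Suc k))}}" for n
      unfolding XX_def by (rule closedin_continuous_map_preimage[OF continuous_map_dist_pair[OF p]]) auto
    ultimately show ?thesis unfolding C_def atLeast_iff atMost_iff
      by (intro closedin_Int closedin_INT) auto
  qed
  moreover have "decseq C"
  proof (rule decseq_SucI)
    fix k
    have "inverse (real (Suc (Suc k))) \<le> inverse (real (Suc k))" by (intro le_imp_inverse_le) auto
    hence "dist (p n x) (p n y) \<le> inverse (real (Suc k))"
      if "\<forall>n\<le>Suc k. dist (p n x) (p n y) \<le> inverse (real (Suc (Suc k)))" "n \<le> k" for n x y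
      using that by (meson le_SucI order_trans)
    thus "C (Suc k) \<subseteq> C k" by (intro subrelI) (simp only: C, blast)
  qed
  moreover have "compact_space XX" unfolding XX_def using X by (simp add: compact_space_prod_topology)
  moreover have "(\<Inter>k. C k) = {}"
  proof (rule ccontr)
    assume "(\<Inter>k. C k) \<noteq> {}"
    then obtain x y where xy: "\<And>k. (x, y) \<in> C k" by auto
    have "p n x = p n y" for n
    proof (rule ccontr)
      assume "p n x \<noteq> p n y"
      then obtain k where k: "inverse (real (Suc k)) < dist (p n x) (p n y)"
        using reals_Archimedean[of "dist (p n x) (p n y)"] by auto
      have "inverse (real (Suc (max n k))) \<le> inverse (real (Suc k))" by (intro le_imp_inverse_le) auto
      moreover have "dist (p n x) (p n y) \<le> inverse (real (Suc (max n k)))"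
        using xy[of "max n k"] unfolding C by (meson max.cobounded1)
      ultimately show False using k by linarith
    qed
    hence "\<phi> x = \<phi> y" using inj xy[of 0] unfolding C by blast
    thus False using xy[of 0] \<delta> unfolding C by simp
  qed
  ultimately obtain k where k: "C k = {}" using compact_space_imp_nest[of XX C] by blast
  have "\<exists>\<epsilon>>0. \<forall>x\<in>topspace X. \<forall>y\<in>topspace X. dist (p m x) (p m y) < \<epsilon> \<longrightarrow> dist (\<phi> x) (\<phi> y) < \<delta>"
    if m: "m \<ge> k" for m
  proof -
    have "\<exists>\<epsilon>>0. \<forall>x\<in>topspace X. \<forall>y\<in>topspace X. dist (p m x) (p m y) < \<epsilon> \<longrightarrow>
      dist (p n x) (p n y) < inverse (real (Suc k))" if "n \<le> k" for n
      using mono[of n m "inverse (real (Suc k))"] that m by simp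
    then obtain \<epsilon> where \<epsilon>: "\<And>n. n \<le> k \<Longrightarrow> \<epsilon> n > 0"
      "\<And>n x y. n \<le> k \<Longrightarrow> x \<in> topspace X \<Longrightarrow> y \<in> topspace X \<Longrightarrow> dist (p m x) (p m y) < \<epsilon> n \<Longrightarrow>
        dist (p n x) (p n y) < inverse (real (Suc k))"
      by metis
    show ?thesis
    proof (intro exI[of _ "Min (\<epsilon> ` {..k})"] conjI ballI impI)
      show "0 < Min (\<epsilon> ` {..k})" using \<epsilon>(1) by (subst Min_gr_iff) auto
      fix x y assume xy: "x \<in> topspace X" "y \<in> topspace X" "dist (p m x) (p m y) < Min (\<epsilon> ` {..k})"
      have "dist (p n x) (p n y) \<le> inverse (real (Suc k))" if "n \<le> k" for n
      proof -
        have "Min (\<epsilon> ` {..k}) \<le> \<epsilon> n" using that by (intro Min_le) auto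
        thus ?thesis using \<epsilon>(2)[OF that xy(1,2)] xy(3) by linarith
      qed
      moreover have "(x, y) \<notin> C k" using k by simp
      ultimately show "dist (\<phi> x) (\<phi> y) < \<delta>" using xy(1,2) unfolding C not_le[symmetric] by blast
    qed
  qed
  thus ?thesis by blast
qed

lemma expansionD:
  assumes "expansion X \<phi> x0 f s p"
  shows "continuous_map X euclidean (p i)" "p i ` topspace X = W2"
    "x \<in> topspace X \<Longrightarrow> p i x = f (s i) (p (Suc i) x)"
proof -
  have "continuous_map X W2top (p i)" using assms unfolding expansion_def by blast
  thus "continuous_map X euclidean (p i)" by (simp add: W2top_def continuous_map_in_subtopology)
qed (use assms in \<open>unfold expansion_def, blast+\<close>)

lemma expansion_in_W2:
  assumes "expansion X \<phi> x0 f s p" "x \<in> topspace X"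
  shows "p i x \<in> W2"
  using expansionD(2)[OF assms(1), of i] assms(2) by blast

lemma expansion_level_uniform:
  assumes e: "expansion X \<phi> x0 f s p" and f: "\<And>\<theta>. positive_map (word \<theta>) (f \<theta>)"
    and "n \<le> m" "\<delta> > 0"
  shows "\<exists>\<epsilon>>0. \<forall>x\<in>topspace X. \<forall>y\<in>topspace X. dist (p m x) (p m y) < \<epsilon> \<longrightarrow> dist (p n x) (p n y) < \<delta>"
  using assms(3)
proof (induction m rule: dec_induct)
  case base
  show ?case using assms(4) by blast
next
  case (step m)
  then obtain \<epsilon> where \<epsilon>: "\<epsilon> > 0"
    "\<And>x y. x \<in> topspace X \<Longrightarrow> y \<in> topspace X \<Longrightarrow> dist (p m x) (p m y) < \<epsilon> \<Longrightarrow> dist (p n x) (p n y) < \<delta>"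
    by blast
  obtain \<mu> where \<mu>: "\<mu> > 0" "\<And>u v. u \<in> W2 \<Longrightarrow> v \<in> W2 \<Longrightarrow> dist u v < \<mu> \<Longrightarrow> dist (f (s m) u) (f (s m) v) < \<epsilon>"
    using positive_map_uniform[OF f \<epsilon>(1)] by blast
  show ?case
  proof (intro exI[of _ \<mu>] conjI ballI impI \<mu>(1))
    fix x y assume *: "x \<in> topspace X" "y \<in> topspace X" "dist (p (Suc m) x) (p (Suc m) y) < \<mu>"
    have "dist (p m x) (p m y) < \<epsilon>"
      unfolding expansionD(3)[OF e *(1), of m] expansionD(3)[OF e *(2), of m]
      by (rule \<mu>(2)) (use * expansion_in_W2[OF e] in auto)
    thus "dist (p n x) (p n y) < \<delta>" using \<epsilon>(2) * by blast
  qed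
qed

text \<open>The projections jointly separate points, by the homeomorphism with the inverse limit.
  This lets cocycles cross a homeomorphism that does not respect levels.\<close>

lemma expansion_uniform:
  fixes h :: "'a \<Rightarrow> 'n::metric_space"
  assumes e: "expansion X \<phi> x0 f s p" and f: "\<And>\<theta>. positive_map (word \<theta>) (f \<theta>)"
    and X: "compact_space X" and h: "continuous_map X euclidean h" and "\<delta> > 0"
  shows "\<exists>N. \<forall>m\<ge>N. \<exists>\<epsilon>>0. \<forall>x\<in>topspace X. \<forall>y\<in>topspace X.
    dist (p m x) (p m y) < \<epsilon> \<longrightarrow> dist (h x) (h y) < \<delta>"
proof (rule compact_tower_uniform[OF X expansionD(1)[OF e] h])
  fix x y assume *: "x \<in> topspace X" "y \<in> topspace X" "\<And>n. p n x = p n y"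
  have "inj_on (\<lambda>x i. p i x) (topspace X)"
    using e unfolding expansion_def by (blast intro: homeomorphic_imp_injective_map)
  moreover have "(\<lambda>i. p i x) = (\<lambda>i. p i y)" using * by blast
  ultimately show "h x = h y" using *(1,2) by (auto dest: inj_onD)
qed (use expansion_level_uniform[OF e f] assms(5) in auto)

lemma expansion_section:
  assumes e: "expansion X \<phi> x0 f s p"
  obtains r where "\<And>u. u \<in> W2 \<Longrightarrow> r u \<in> topspace X" "\<And>u. u \<in> W2 \<Longrightarrow> p m (r u) = u"
proof -
  have "\<forall>u\<in>W2. \<exists>x\<in>topspace X. p m x = u" using expansionD(2)[OF e, of m] by (metis imageE)
  thus ?thesis using that by metis
qed

section \<open>Classes induced on a level\<close>

lemma cohomologous_on_cong:
  assumes "cohomologous_on p S c c'"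
    "\<And>x y. x \<in> S \<Longrightarrow> y \<in> S \<Longrightarrow> c x y = d x y" "\<And>x y. x \<in> S \<Longrightarrow> y \<in> S \<Longrightarrow> c' x y = d' x y"
  shows "cohomologous_on p S d d'"
  using assms unfolding cohomologous_on_def by simp

text \<open>\<open>B\<close> describes the class that the cocycle \<open>d\<close> induces on the level with projection \<open>q\<close>.\<close>

definition represents ::
  "('a \<Rightarrow> complex) \<Rightarrow> 'a set \<Rightarrow> ('a \<Rightarrow> 'a \<Rightarrow> 'g::group_add) \<Rightarrow> (letter \<Rightarrow> 'g) \<Rightarrow> bool" where
  "represents q S d B \<longleftrightarrow> (\<exists>e \<delta>. \<delta> > 0 \<and> cocycle_on (\<lambda>u. u) W2 \<delta> e \<and> holonomy e B \<and>
     cohomologous_on q S d (\<lambda>x y. e (q x) (q y)))"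

lemma represents_exists:
  assumes d: "cocycle_on q S \<delta> d" "\<delta> > 0" and q: "q ` S = W2"
  shows "\<exists>B. represents q S d B"
proof -
  obtain r where r: "\<And>u. u \<in> W2 \<Longrightarrow> r u \<in> S" "\<And>u. u \<in> W2 \<Longrightarrow> q (r u) = u"
    using f_inv_into_f[of _ q S] inv_into_into[of _ q S] q by metis
  define e where "e u v = d (r u) (r v)" for u v
  have e: "cocycle_on (\<lambda>u. u) W2 \<delta> e" unfolding e_def
    by (rule cocycle_on_pullback[OF d(1)]) (use r in auto)
  obtain B where B: "holonomy e B" using holonomy_exists[OF e d(2)] by blast
  have rq: "r (q x) \<in> S" "q (r (q x)) = q x" if "x \<in> S" for x using r[of "q x"] q that by blast+
  have "cohomologous_on q S d (\<lambda>x y. e (q x) (q y))"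
    unfolding cohomologous_on_def e_def
  \<comment> \<open>A point and its chosen representative \<open>r (q x)\<close> have the same
    projection, so the cocycle identity covers the transition between them.\<close>
  proof (intro exI[of _ \<delta>] conjI exI[of _ "\<lambda>x. d x (r (q x))"] ballI impI d(2))
    fix x y assume xy: "x \<in> S" "y \<in> S" "dist (q x) (q y) < \<delta>"
    have 1: "d x (r (q x)) + d (r (q x)) (r (q y)) = d x (r (q y))"
      by (rule cocycle_onD[OF d(1)]) (use xy rq d(2) in auto)
    have 2: "d x y + d y (r (q y)) = d x (r (q y))"
      by (rule cocycle_onD[OF d(1)]) (use xy rq d(2) in auto)
    show "d (r (q x)) (r (q y)) = - d x (r (q x)) + d x y + d y (r (q y))"
      unfolding add.assoc 2 unfolding 1[symmetric] by simp
  qed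
  thus ?thesis unfolding represents_def using e B d(2) by blast
qed

text \<open>One level up, the holonomies become their images under \<open>pull_word (s m)\<close>,
  and conjugacy there yields a coboundary. Classes distinct at level \<open>m\<close> may merge in
  this way.\<close>

lemma represents_conjugate_imp_cohomologous:
  assumes e: "expansion X \<phi> x0 f s q" and f: "\<And>\<theta>. positive_map (word \<theta>) (f \<theta>)"
    and d: "represents (q m) (topspace X) d B" and d': "represents (q m) (topspace X) d' B'"
    and conj: "conjugate (pull_word (s m) B) (pull_word (s m) B')"
  shows "cohomologous_on (q (Suc m)) (topspace X) d d'"
proof -
  let ?S = "topspace X" and ?f = "f (s m)"
  obtain c \<delta> where c: "\<delta> > 0" "cocycle_on (\<lambda>u. u) W2 \<delta> c" "holonomy c B"
    "cohomologous_on (q m) ?S d (\<lambda>x y. c (q m x) (q m y))"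
    using d unfolding represents_def by blast
  obtain c' \<delta>' where c': "\<delta>' > 0" "cocycle_on (\<lambda>u. u) W2 \<delta>' c'" "holonomy c' B'"
    "cohomologous_on (q m) ?S d' (\<lambda>x y. c' (q m x) (q m y))"
    using d' unfolding represents_def by blast
  obtain \<epsilon> where \<epsilon>: "\<epsilon> > 0" "cocycle_on (\<lambda>u. u) W2 \<epsilon> (\<lambda>u v. c (?f u) (?f v))"
    using positive_map_cocycle[OF f c(2,1)] .
  obtain \<epsilon>' where \<epsilon>': "\<epsilon>' > 0" "cocycle_on (\<lambda>u. u) W2 \<epsilon>' (\<lambda>u v. c' (?f u) (?f v))"
    using positive_map_cocycle[OF f c'(2,1)] .
  have "cohomologous_on (\<lambda>u. u) W2 (\<lambda>u v. c (?f u) (?f v)) (\<lambda>u v. c' (?f u) (?f v))"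
    by (rule conjugate_imp_cohomologous[OF \<epsilon>(2,1) \<epsilon>'(2,1) holonomy_pullback[OF f c(2,1,3)]
          holonomy_pullback[OF f c'(2,1,3)] conj])
  hence "cohomologous_on (q (Suc m)) ?S (\<lambda>x y. c (?f (q (Suc m) x)) (?f (q (Suc m) y)))
      (\<lambda>x y. c' (?f (q (Suc m) x)) (?f (q (Suc m) y)))"
    by (rule cohomologous_on_pullback) (use expansion_in_W2[OF e] in blast)+
  hence mid: "cohomologous_on (q (Suc m)) ?S (\<lambda>x y. c (q m x) (q m y)) (\<lambda>x y. c' (q m x) (q m y))"
    by (rule cohomologous_on_cong) (simp_all add: expansionD(3)[OF e, of _ m])
  have up: "cohomologous_on (q (Suc m)) ?S a b" if "cohomologous_on (q m) ?S a b" for a b :: "'a \<Rightarrow> 'a \<Rightarrow> 'b"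
    using cohomologous_on_pullback[OF that, of "\<lambda>x. x" ?S "q (Suc m)"]
      expansion_level_uniform[OF e f, of m "Suc m"] by simp
  show ?thesis
    using cohomologous_on_trans[OF up[OF c(4)] cohomologous_on_trans[OF mid cohomologous_on_sym[OF up[OF c'(4)]]]] .
qed

text \<open>Descent to the wedge at level \<open>k\<close> gives conjugacy of iterated images under
  \<open>pull_word\<close>; for \<open>Sig\<close> and \<open>Rho\<close> each application can be
  cancelled.\<close>

lemma cohomologous_wedge_cocycle_imp_conjugate:
  assumes e: "expansion X \<phi> x0 f s p" and f: "\<And>\<theta>. positive_map (word \<theta>) (f \<theta>)"
    and s: "\<And>i. s i \<in> {Sig, Rho}"
    and coh: "cohomologous_on (p k) (topspace X) (\<lambda>x y. wedge_cocycle A (p 0 x) (p 0 y))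
      (\<lambda>x y. wedge_cocycle A' (p 0 x) (p 0 y))"
  shows "conjugate A A'"
proof -
  \<comment> \<open>\<open>Q k\<close> is the composite of \<open>f (s 0)\<close> up to
    \<open>f (s (k - 1))\<close>, leading from level \<open>k\<close> to level 0;
    \<open>W B k\<close> below is the holonomy that \<open>B\<close> acquires at level
    \<open>k\<close>.\<close>
  define Q where "Q = rec_nat (\<lambda>u. u) (\<lambda>k q u. q (f (s k) u))"
  have Q: "Q 0 = (\<lambda>u. u)" "Q (Suc k) = (\<lambda>u. Q k (f (s k) u))" for k by (simp_all add: Q_def)
  define W where "W B = rec_nat B (\<lambda>k. pull_word (s k))" for B :: "letter \<Rightarrow> 'b"
  have W: "W B 0 = B" "W B (Suc k) = pull_word (s k) (W B k)" for B k by (simp_all add: W_def)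
  have hol: "\<exists>\<delta>>0. cocycle_on (\<lambda>u. u) W2 \<delta> (\<lambda>u v. wedge_cocycle B (Q k u) (Q k v)) \<and>
      holonomy (\<lambda>u v. wedge_cocycle B (Q k u) (Q k v)) (W B k)" for B k
  proof (induction k)
    case 0
    show ?case
      by (intro exI[of _ "1/2"]) (simp add: Q W cocycle_on_wedge_cocycle holonomy_wedge_cocycle)
  next
    case (Suc k)
    then obtain \<delta> where \<delta>: "\<delta> > 0" "cocycle_on (\<lambda>u. u) W2 \<delta> (\<lambda>u v. wedge_cocycle B (Q k u) (Q k v))"
      "holonomy (\<lambda>u v. wedge_cocycle B (Q k u) (Q k v)) (W B k)" by blast
    obtain \<epsilon> where "\<epsilon> > 0" "cocycle_on (\<lambda>u. u) W2 \<epsilon> (\<lambda>u v. wedge_cocycle B (Q (Suc k) u) (Q (Suc k) v))"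
      using positive_map_cocycle[OF f \<delta>(2,1)] unfolding Q(2) by blast
    moreover have "holonomy (\<lambda>u v. wedge_cocycle B (Q (Suc k) u) (Q (Suc k) v)) (W B (Suc k))"
      unfolding Q(2) W(2) by (rule holonomy_pullback[OF f \<delta>(2,1,3)])
    ultimately show ?case by blast
  qed
  have p0: "p 0 x = Q k (p k x)" if "x \<in> topspace X" for x k
    by (induction k) (simp_all add: Q expansionD(3)[OF e that, symmetric])
  \<comment> \<open>An arbitrary section moves the relation to the wedge;
    \<open>p k (r u) = u\<close> leaves distances unchanged.\<close>
  obtain r where r: "\<And>u. u \<in> W2 \<Longrightarrow> r u \<in> topspace X" "\<And>u. u \<in> W2 \<Longrightarrow> p k (r u) = u"
    using expansion_section[OF e] by blast
  have "cohomologous_on (\<lambda>u. u) W2 (\<lambda>u v. wedge_cocycle A (p 0 (r u)) (p 0 (r v)))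
      (\<lambda>u v. wedge_cocycle A' (p 0 (r u)) (p 0 (r v)))"
  proof (rule cohomologous_on_pullback[OF coh])
    show "\<exists>\<epsilon>>0. \<forall>u\<in>W2. \<forall>v\<in>W2. dist u v < \<epsilon> \<longrightarrow> dist (p k (r u)) (p k (r v)) < \<delta>"
      if "\<delta> > 0" for \<delta>
      using that by (intro exI[of _ \<delta>]) (simp add: r(2))
  qed (use r(1) in blast)
  hence "cohomologous_on (\<lambda>u. u) W2 (\<lambda>u v. wedge_cocycle A (Q k u) (Q k v))
      (\<lambda>u v. wedge_cocycle A' (Q k u) (Q k v))"
    by (rule cohomologous_on_cong) (simp_all add: p0[of _ k] r)
  hence "conjugate (W A k) (W A' k)"
    using cohomologous_imp_conjugate hol by blast
  moreover have "conjugate A A'" if "conjugate (W A k) (W A' k)" for k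
    using that
    by (induction k) (auto simp: W dest: conjugate_pull_word_cancel[OF _ s])
  ultimately show ?thesis by blast
qed

subsection \<open>Counting classes\<close>

text \<open>As \<open>\<Phi>\<close> is not assumed to respect \<open>R\<close>, it is evaluated on
  one representative per class. The resulting self-map of the finite set of classes is injective,
  hence onto.\<close>

lemma equivp_pigeonhole:
  fixes R :: "'a::finite \<Rightarrow> 'a \<Rightarrow> bool"
  assumes R: "equivp R" and \<Phi>: "\<And>x y. R (\<Phi> x) (\<Phi> y) \<Longrightarrow> R x y"
  shows "\<exists>T. (\<forall>x\<in>T. \<forall>y\<in>T. R x y \<longrightarrow> x = y) \<and> (\<forall>b. \<exists>x\<in>T. R (\<Phi> x) b)"
proof -
  have eq: "R x y \<longleftrightarrow> R x = R y" for x y using R unfolding equivp_def by blast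
  define rep where "rep q = (SOME x. q = R x)" for q
  have rep: "R (rep q) = q" if "q \<in> range R" for q
    using that unfolding rep_def by (metis (mono_tags, lifting) imageE someI_ex)
  define F where "F q = R (\<Phi> (rep q))" for q
  have "inj_on F (range R)"
  proof (rule inj_onI)
    fix q q' assume *: "q \<in> range R" "q' \<in> range R" "F q = F q'"
    hence "R (rep q) (rep q')" using \<Phi> eq unfolding F_def by blast
    thus "q = q'" using rep * eq by metis
  qed
  hence F: "F ` range R = range R" by (intro endo_inj_surj) (auto simp: F_def)
  have "\<exists>x\<in>rep ` range R. R (\<Phi> x) b" for b
  proof -
    obtain q where "q \<in> range R" "F q = R b" using F by (metis imageE rangeI)
    thus ?thesis unfolding F_def using eq by blast
  qed
  moreover have "\<forall>x\<in>rep ` range R. \<forall>y\<in>rep ` range R. R x y \<longrightarrow> x = y"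
    using rep eq by (metis imageE)
  ultimately show ?thesis by blast
qed

lemma equivp_conjugate: "equivp (conjugate :: (letter \<Rightarrow> 'g::group_add) \<Rightarrow> _)"
proof (rule equivpI)
  show "reflp (conjugate :: (letter \<Rightarrow> 'g) \<Rightarrow> _)"
    unfolding conjugate_def by (intro reflpI exI[of _ 0]) simp
  show "symp (conjugate :: (letter \<Rightarrow> 'g) \<Rightarrow> _)"
  proof (rule sympI)
    fix A B :: "letter \<Rightarrow> 'g" assume "conjugate A B"
    then obtain k where k: "\<And>x. B x = - k + A x + k" unfolding conjugate_def by blast
    show "conjugate B A" unfolding conjugate_def k
      by (intro exI[of _ "- k"]) (simp add: group_normalize del: add_uminus_conv_diff)
  qed
  show "transp (conjugate :: (letter \<Rightarrow> 'g) \<Rightarrow> _)"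
  proof (rule transpI)
    fix A B C :: "letter \<Rightarrow> 'g" assume "conjugate A B" "conjugate B C"
    then obtain k l where kl: "\<And>x. B x = - k + A x + k" "\<And>x. C x = - l + B x + l"
      unfolding conjugate_def by blast
    show "conjugate A C" unfolding conjugate_def kl
      by (intro exI[of _ "k + l"]) (simp add: group_normalize del: add_uminus_conv_diff)
  qed
qed

section \<open>Coefficients in the symmetric group\<close>

instance letter :: finite
proof
  have "UNIV = {La, Lb}" using letter.exhaust by auto
  thus "finite (UNIV :: letter set)" by (metis finite.emptyI finite.insertI)
qed

text \<open>\<open>S3 e k\<close> is the product of the \<open>e\<close>-th power of a reflection and the \<open>k\<close>-th power of a rotation.\<close>

datatype s3 = S3 (flip: bool) (turn: 3)

instantiation s3 :: "{group_add, finite}"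
begin

definition "0 = S3 False 0"
text \<open>A rotation is inverted when it moves past a reflection.\<close>

definition "g + h = S3 (flip g \<noteq> flip h) ((if flip h then - turn g else turn g) + turn h)"
definition "- g = S3 (flip g) (if flip g then turn g else - turn g)"
definition "g - h = g + - (h::s3)"

instance
proof
  fix a b c :: s3
  show "a + b + c = a + (b + c)" by (cases a; cases b; cases c) (auto simp: plus_s3_def)
  show "0 + a = a" by (cases a) (simp add: plus_s3_def zero_s3_def)
  show "a + 0 = a" by (cases a) (simp add: plus_s3_def zero_s3_def)
  show "- a + a = 0" by (cases a) (simp add: plus_s3_def zero_s3_def uminus_s3_def)
  show "a + - b = a - b" by (simp add: minus_s3_def)
  have "UNIV = (\<lambda>(e, k). S3 e k) ` UNIV"
    by (rule set_eqI) (metis case_prod_conv image_eqI iso_tuple_UNIV_I s3.exhaust)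
  thus "finite (UNIV :: s3 set)" by (metis finite finite_imageI)
qed

end

text \<open>Under \<open>B\<close> both words give \<open>s\<close>. Under \<open>B'\<close> the
  block aab becomes \<open>r\<close>, so the words aab aab ab and ab aab give
  \<open>r + r + s + r\<close> and \<open>s + r + r\<close>, both equal to
  \<open>- r + s + r\<close>. The pairs differ since 0 is conjugate only to itself.\<close>

lemma pull_word_Tau_not_injective:
  obtains B B' :: "letter \<Rightarrow> s3"
  where "\<not> conjugate B B'" "conjugate (pull_word Tau B) (pull_word Tau B')"
proof -
  define s r where "s = S3 True 0" and "r = S3 False 1"
  define B B' where "B = (\<lambda>x. case x of La \<Rightarrow> s | Lb \<Rightarrow> 0)"
    and "B' = (\<lambda>x. case x of La \<Rightarrow> s | Lb \<Rightarrow> r)"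
  note defs = plus_s3_def zero_s3_def uminus_s3_def s_def r_def
  have "\<not> conjugate B B'"
  proof
    assume "conjugate B B'"
    then obtain k where "B' Lb = - k + B Lb + k" unfolding conjugate_def by blast
    hence "r = 0" by (simp add: B_def B'_def)
    thus False by (simp add: defs)
  qed
  moreover have "pull_word Tau B' x = - r + pull_word Tau B x + r" for x
    by (cases x) (simp_all add: pull_word_def B_def B'_def, simp_all add: defs)
  ultimately show ?thesis using that unfolding conjugate_def by blast
qed

section \<open>Separation of the two families\<close>

theorem theorem8p5:
  fixes f :: "sym \<Rightarrow> complex \<Rightarrow> complex"
    and X :: "'a topology" and \<phi> :: "real \<Rightarrow> 'a \<Rightarrow> 'a"
    and Y :: "'b topology" and \<psi> :: "real \<Rightarrow> 'b \<Rightarrow> 'b"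
  assumes "positive_map (word Sig) (f Sig)"
    and "positive_map (word Tau) (f Tau)"
    and "positive_map (word Rho) (f Rho)"
    and "nonconstant_Sigma f X \<phi>"
    and "nonconstant_T f Y \<psi>"
  shows "\<not> flow_equiv X \<phi> Y \<psi>"
proof
  assume "flow_equiv X \<phi> Y \<psi>"
  then obtain h g where hg: "homeomorphic_maps X Y h g"
    unfolding flow_equiv_def homeomorphic_map_maps by blast
  have h: "continuous_map X Y h" "h ` topspace X \<subseteq> topspace Y" and g: "continuous_map Y X g"
    and gh: "\<And>x. x \<in> topspace X \<Longrightarrow> g (h x) = x"
    using hg unfolding homeomorphic_maps_def by (auto simp: continuous_map_def)
  have f: "positive_map (word \<theta>) (f \<theta>)" for \<theta> using assms(1-3) by (cases \<theta>) auto
  obtain x0 s p where X: "expansion X \<phi> x0 f s p" and s: "\<And>i. s i \<in> {Sig, Rho}"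
    using assms(4) unfolding nonconstant_in_def by blast
  obtain y0 t q where Y: "expansion Y \<psi> y0 f t q" and t: "\<And>i. t i \<in> {Tau, Rho}"
    and nonconst: "\<not> (\<exists>c. tail_equiv t (\<lambda>_. c))"
    using assms(5) unfolding nonconstant_in_def by blast
  have compact: "compact_space X" "compact_space Y"
    using assms(4,5) unfolding nonconstant_in_def flow_space_def by blast+
  have "continuous_map Y euclidean (\<lambda>y. p 0 (g y))"
    using continuous_map_compose[OF g expansionD(1)[OF X, of 0]] by (simp add: o_def)
  \<comment> \<open>1/2 is the scale at which \<open>wedge_cocycle\<close> satisfies the cocycle
    identity.\<close>
  then obtain N where N: "\<And>m. m \<ge> N \<Longrightarrow> \<exists>\<epsilon>>0. \<forall>x\<in>topspace Y. \<forall>y\<in>topspace Y.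
      dist (q m x) (q m y) < \<epsilon> \<longrightarrow> dist (p 0 (g x)) (p 0 (g y)) < 1/2"
    using expansion_uniform[OF Y f compact(2), of "\<lambda>y. p 0 (g y)" "1/2"] by auto
  \<comment> \<open>A tail without \<open>Tau\<close> would be constantly
    \<open>Rho\<close>.\<close>
  obtain m where m: "m \<ge> N" "t m = Tau"
  proof (rule ccontr)
    assume "\<not> thesis"
    hence "t (N + j) = Rho" for j using t[of "N + j"] that[of "N + j"] by auto
    thus False using nonconst unfolding tail_equiv_def by blast
  qed
  obtain \<epsilon> where \<epsilon>: "\<epsilon> > 0" "\<And>x y. x \<in> topspace Y \<Longrightarrow> y \<in> topspace Y \<Longrightarrow>
      dist (q m x) (q m y) < \<epsilon> \<Longrightarrow> dist (p 0 (g x)) (p 0 (g y)) < 1/2"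
    using N[OF m(1)] by blast
  \<comment> \<open>The class \<open>A\<close> of level 0 of the first space, carried to the second
    space by \<open>g\<close>; \<open>\<Phi> A\<close> will be its holonomy at level
    \<open>m\<close>.\<close>
  define d where "d A y y' = wedge_cocycle A (p 0 (g y)) (p 0 (g y'))" for A :: "letter \<Rightarrow> s3" and y y'
  have "cocycle_on (q m) (topspace Y) \<epsilon> (d A)" for A
    unfolding d_def
  proof (rule cocycle_on_pullback[OF cocycle_on_wedge_cocycle])
    show "(\<lambda>y. p 0 (g y)) ` topspace Y \<subseteq> W2"
      using expansion_in_W2[OF X] g by (auto simp: continuous_map_def)
  qed (use \<epsilon> in auto)
  hence "\<exists>B. represents (q m) (topspace Y) (d A) B" for A
    using represents_exists \<epsilon>(1) expansionD(2)[OF Y] by blast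
  then obtain \<Phi> where \<Phi>: "\<And>A. represents (q m) (topspace Y) (d A) (\<Phi> A)" by metis
  \<comment> \<open>Cohomology at level \<open>Suc m\<close> of the second space is carried back by
    \<open>h\<close> to some level of the first, where classes from level 0 have not merged.\<close>
  have key: "conjugate A A'" if conj: "conjugate (pull_word Tau (\<Phi> A)) (pull_word Tau (\<Phi> A'))" for A A'
  proof -
    have "cohomologous_on (q (Suc m)) (topspace Y) (d A) (d A')"
      by (rule represents_conjugate_imp_cohomologous[OF Y f \<Phi> \<Phi>]) (use conj m in simp)
    then obtain \<delta> k where \<delta>: "\<delta> > 0" and k: "\<And>x y. x \<in> topspace Y \<Longrightarrow> y \<in> topspace Y \<Longrightarrow>
        dist (q (Suc m) x) (q (Suc m) y) < \<delta> \<Longrightarrow> d A' x y = - k x + d A x y + k y"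
      unfolding cohomologous_on_def by blast
    have "continuous_map X euclidean (\<lambda>x. q (Suc m) (h x))"
      using continuous_map_compose[OF h(1) expansionD(1)[OF Y, of "Suc m"]] by (simp add: o_def)
    then obtain n \<mu> where \<mu>: "\<mu> > 0" "\<And>x y. x \<in> topspace X \<Longrightarrow> y \<in> topspace X \<Longrightarrow>
        dist (p n x) (p n y) < \<mu> \<Longrightarrow> dist (q (Suc m) (h x)) (q (Suc m) (h y)) < \<delta>"
      using expansion_uniform[OF X f compact(1) _ \<delta>, of "\<lambda>x. q (Suc m) (h x)"] by blast
    have "cohomologous_on (p n) (topspace X) (\<lambda>x y. d A (h x) (h y)) (\<lambda>x y. d A' (h x) (h y))"
      unfolding cohomologous_on_def
      using \<mu> k h(2) by (intro exI[of _ \<mu>] conjI exI[of _ "\<lambda>x. k (h x)"]) (auto simp: image_subset_iff)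
    hence "cohomologous_on (p n) (topspace X) (\<lambda>x y. wedge_cocycle A (p 0 x) (p 0 y))
        (\<lambda>x y. wedge_cocycle A' (p 0 x) (p 0 y))"
      by (rule cohomologous_on_cong) (simp_all add: d_def gh)
    thus ?thesis by (rule cohomologous_wedge_cocycle_imp_conjugate[OF X f s])
  qed
  \<comment> \<open>Up to conjugacy \<open>\<Phi>\<close> is onto, so its values include two classes
    that \<open>Tau\<close> merges; by \<open>key\<close> they come from the same element of
    \<open>T\<close>, a contradiction.\<close>
  obtain T where T: "\<And>A A'. A \<in> T \<Longrightarrow> A' \<in> T \<Longrightarrow> conjugate A A' \<Longrightarrow> A = A'"
    and onto: "\<And>B. \<exists>A\<in>T. conjugate (\<Phi> A) B"
    using equivp_pigeonhole[OF equivp_conjugate, of \<Phi>] key[OF conjugate_pull_word] by blast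
  obtain B B' :: "letter \<Rightarrow> s3"
    where B: "\<not> conjugate B B'" "conjugate (pull_word Tau B) (pull_word Tau B')"
    by (rule pull_word_Tau_not_injective)
  obtain A A' where A: "A \<in> T" "conjugate (\<Phi> A) B" "A' \<in> T" "conjugate (\<Phi> A') B'"
    using onto by blast
  note sym = equivp_symp[OF equivp_conjugate] and trans = equivp_transp[OF equivp_conjugate]
  have "conjugate (pull_word Tau (\<Phi> A)) (pull_word Tau (\<Phi> A'))"
    by (rule trans[OF conjugate_pull_word[OF A(2)] trans[OF B(2) sym[OF conjugate_pull_word[OF A(4)]]]])
  hence "A = A'" using T[OF A(1,3)] key by blast
  thus False using trans[OF sym[OF A(2)]] A(4) B(1) by blast
qed

end
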